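(* The radical distance of the graphic (cycle) matroid $M(K_{3,5})$ of the complete bipartite graph $K_{3,5}$ is $d\bigl(M(K_{3,5})\bigr)=6$.
   Context: **Class $\mathcal{M}_\ell$.** Let $\ell$ be a prime. Let $R$ be a regular matroid of rank $g$ on a finite ground set $S$, and choose a totally unimodular matrix $A\in\mathbb{Z}^{g\times|S|}$ of rank $g$ (columns indexed by $S$, of the form $(I_g\mid D)$ after ordering $S$) realizing $R$. Let $U=U(R)\subset\mathbb{Z}^S$ be the lattice spanned by the rows of $A$ (for a graphic matroid $M(G)$, $U$ is the cut lattice of $G$), and let $\bar U\subset\mathbb{F}_\ell^S$ be its reduction mod $\ell$, of dimension $g$. The notions below do not depend on the choice of $A$. The Albanese graph $\mathrm{Alb}_\ell(R)$ is the oriented $S$-colored graph with vertex set $V=\mathbb{F}_\ell^S/\bar U$ and, for each $[v]\in V$ and $s\in S$, exactly one oriented edge of color $s$ from $[v]$ to $[v+e_s]$, where $e_s$ is the standard basis vector. A 1-chain is an $\mathbb{F}_\ell$-linear combination of oriented edges; the boundary $\partial$ sends an edge from $[v]$ to $[w]$ to $[w]-[v]$; a 1-chain is closed if its boundary is $0$. The color profile is the linear map $\lambda$ from 1-chains to $\mathbb{F}_\ell^S$ sending each edge of color $s$ to $e_s$; $\lambda_s(b)$ is the $s$-component of $\lambda(b)$. A $\mathbb{Z}/\ell$-solution of $R$ in $\mathrm{Alb}_\ell(R)$ is a family $(b_s)_{s\in S}$ of 1-chains over $\mathbb{F}_\ell$, with $b_s$ supported on the edges of color $s$, such that $\sum_{s}c_s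 b_s$ is closed whenever $\sum_s c_s e_s\in\bar U$. $\mathcal{M}_\ell$ is the class of regular matroids $R$ admitting a $\mathbb{Z}/\ell$-solution in $\mathrm{Alb}_\ell(R)$ for which there is $c\in(\mathbb{Z}/\ell)^\times$ with $\lambda_s(b_s)=c$ for all $s\in S$. **Radical distance.** For a regular matroid $R$, $d(R):=\operatorname{lcm}\{\ell\text{ prime}: R\notin\mathcal{M}_\ell\}$ (the set of such primes is finite; the lcm of the empty set is $1$). *)

theory Defs
  imports "HOL-Computational_Algebra.Primes" "HOL-Library.FuncSet" "Jordan_Normal_Form.Determinant"
begin

section \<open>Matroids and cycle matroids of simple graphs\<close>

record 'a matroid =
  ground :: "'a set"
  indep :: "'a set set"

definition is_matroid :: "'a matroid \<Rightarrow> bool" where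
  "is_matroid M \<longleftrightarrow>
     finite (ground M) \<and>
     indep M \<subseteq> Pow (ground M) \<and>
     {} \<in> indep M \<and>
     (\<forall>X Y. X \<in> indep M \<longrightarrow> Y \<subseteq> X \<longrightarrow> Y \<in> indep M) \<and>
     (\<forall>X Y. X \<in> indep M \<longrightarrow> Y \<in> indep M \<longrightarrow> card X < card Y \<longrightarrow>
        (\<exists>y \<in> Y - X. insert y X \<in> indep M))"

text \<open>A simple graph is a pair of a vertex set and a set of edges, each edge being a
  two-element set of vertices.\<close>

type_synonym 'v sgraph = "'v set \<times> 'v set set"

definition is_cycle :: "'v set set \<Rightarrow> 'v list \<Rightarrow> bool" where
  "is_cycle F p \<longleftrightarrow>
     3 \<le> length p \<and> distinct p \<and>
     (\<forall>i < length p. {p ! i, p ! (Suc i mod length p)} \<in> F)"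

definition cycle_matroid :: "'v sgraph \<Rightarrow> 'v set matroid" where
  "cycle_matroid G =
     \<lparr> ground = snd G, indep = {F. F \<subseteq> snd G \<and> (\<nexists>p. is_cycle F p)} \<rparr>"

definition complete_bipartite :: "nat \<Rightarrow> nat \<Rightarrow> (nat + nat) sgraph" where
  "complete_bipartite m n =
     (Inl ` {..<m} \<union> Inr ` {..<n}, {{Inl i, Inr j} | i j. i < m \<and> j < n})"

section \<open>Regular matroids\<close>

text \<open>A matrix with \<open>g\<close> rows and columns indexed by \<open>S\<close> is a function
  \<open>A :: nat \<Rightarrow> 'a \<Rightarrow> int\<close>; only the entries \<open>A i s\<close> with \<open>i < g\<close>, \<open>s \<in> S\<close> matter.\<close>

definition totally_unimodular :: "nat \<Rightarrow> 'a set \<Rightarrow> (nat \<Rightarrow> 'a \<Rightarrow> int) \<Rightarrow> bool" where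
  "totally_unimodular g S A \<longleftrightarrow>
     (\<forall>k r q. r \<in> {..<k} \<rightarrow> {..<g} \<longrightarrow> inj_on r {..<k} \<longrightarrow>
              q \<in> {..<k} \<rightarrow> S \<longrightarrow> inj_on q {..<k} \<longrightarrow>
        det (mat k k (\<lambda>(i, j). A (r i) (q j))) \<in> {-1, 0, 1})"

text \<open>The shape \<open>(I | D)\<close> after ordering \<open>S\<close>: the columns \<open>\<beta> 0, \<dots>, \<beta> (g - 1)\<close>
  come first and form the identity matrix. In particular, the rank of \<open>A\<close> is \<open>g\<close>.\<close>

definition standard_form :: "nat \<Rightarrow> 'a set \<Rightarrow> (nat \<Rightarrow> 'a \<Rightarrow> int) \<Rightarrow> bool" where
  "standard_form g S A \<longleftrightarrow>
     (\<exists>\<beta>. \<beta> \<in> {..<g} \<rightarrow> S \<and> inj_on \<beta> {..<g} \<and>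
          (\<forall>i < g. \<forall>j < g. A i (\<beta> j) = (if i = j then 1 else 0)))"

definition columns_independent :: "nat \<Rightarrow> (nat \<Rightarrow> 'a \<Rightarrow> int) \<Rightarrow> 'a set \<Rightarrow> bool" where
  "columns_independent g A X \<longleftrightarrow>
     (\<forall>x :: 'a \<Rightarrow> rat. (\<forall>i < g. (\<Sum>s\<in>X. x s * of_int (A i s)) = 0) \<longrightarrow> (\<forall>s\<in>X. x s = 0))"

definition realizes :: "nat \<Rightarrow> (nat \<Rightarrow> 'a \<Rightarrow> int) \<Rightarrow> 'a matroid \<Rightarrow> bool" where
  "realizes g A R \<longleftrightarrow>
     totally_unimodular g (ground R) A \<and> standard_form g (ground R) A \<and>
     (\<forall>X \<subseteq> ground R. X \<in> indep R \<longleftrightarrow> columns_independent g A X)"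

definition regular_matroid :: "'a matroid \<Rightarrow> bool" where
  "regular_matroid R \<longleftrightarrow> is_matroid R \<and> (\<exists>g A. realizes g A R)"

section \<open>The Albanese graph\<close>

text \<open>The field with \<open>l\<close> elements (\<open>l\<close> prime) is represented by the residues
  \<open>{0..<int l}\<close>, vectors over it by extensional functions on \<open>S\<close>.\<close>

definition Fl :: "nat \<Rightarrow> int set" where
  "Fl l = {0..<int l}"

definition reduce :: "nat \<Rightarrow> 'a set \<Rightarrow> ('a \<Rightarrow> int) \<Rightarrow> 'a \<Rightarrow> int" where
  "reduce l S v = (\<lambda>s\<in>S. v s mod int l)"

definition row_lattice :: "nat \<Rightarrow> 'a set \<Rightarrow> (nat \<Rightarrow> 'a \<Rightarrow> int) \<Rightarrow> ('a \<Rightarrow> int) set" where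
  "row_lattice g S A = {(\<lambda>s\<in>S. \<Sum>i<g. z i * A i s) | z :: nat \<Rightarrow> int. True}"

definition row_lattice_mod :: "nat \<Rightarrow> nat \<Rightarrow> 'a set \<Rightarrow> (nat \<Rightarrow> 'a \<Rightarrow> int) \<Rightarrow> ('a \<Rightarrow> int) set" where
  "row_lattice_mod l g S A = reduce l S ` row_lattice g S A"

text \<open>The class of \<open>v\<close> modulo a subspace \<open>W\<close>. The argument \<open>v\<close> may be any integer
  vector, it is read modulo \<open>l\<close>.\<close>

definition coset :: "nat \<Rightarrow> 'a set \<Rightarrow> ('a \<Rightarrow> int) set \<Rightarrow> ('a \<Rightarrow> int) \<Rightarrow> ('a \<Rightarrow> int) set" where
  "coset l S W v = {reduce l S (\<lambda>s. v s + w s) | w. w \<in> W}"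

type_synonym 'a vertex = "('a \<Rightarrow> int) set"

text \<open>An oriented colored edge is a triple (tail, color, head).\<close>

type_synonym 'a edge = "'a vertex \<times> 'a \<times> 'a vertex"

fun tail :: "'a edge \<Rightarrow> 'a vertex" where "tail (x, s, y) = x"
fun color :: "'a edge \<Rightarrow> 'a" where "color (x, s, y) = s"
fun head :: "'a edge \<Rightarrow> 'a vertex" where "head (x, s, y) = y"

definition Alb_verts :: "nat \<Rightarrow> 'a set \<Rightarrow> ('a \<Rightarrow> int) set \<Rightarrow> 'a vertex set" where
  "Alb_verts l S W = coset l S W ` (S \<rightarrow>\<^sub>E Fl l)"

text \<open>Since the class of \<open>v + e\<^sub>s\<close> depends only on the class of \<open>v\<close> when \<open>W\<close> is a
  subspace, this set has exactly one edge of each color leaving each vertex.\<close>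

definition Alb_edges :: "nat \<Rightarrow> 'a set \<Rightarrow> ('a \<Rightarrow> int) set \<Rightarrow> 'a edge set" where
  "Alb_edges l S W =
     {(coset l S W v, s, coset l S W (v(s := v s + 1))) | v s. v \<in> S \<rightarrow>\<^sub>E Fl l \<and> s \<in> S}"

section \<open>Chains and solutions\<close>

definition chains :: "nat \<Rightarrow> 'a edge set \<Rightarrow> ('a edge \<Rightarrow> int) set" where
  "chains l E = E \<rightarrow>\<^sub>E Fl l"

text \<open>The coefficient at the vertex \<open>x\<close> of the boundary, as an integer that is to be
  read modulo \<open>l\<close>.\<close>

definition boundary :: "'a edge set \<Rightarrow> ('a edge \<Rightarrow> int) \<Rightarrow> 'a vertex \<Rightarrow> int" where
  "boundary E b x = (\<Sum>e\<in>E. b e * (of_bool (head e = x) - of_bool (tail e = x)))"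

definition closed_chain ::
    "nat \<Rightarrow> 'a vertex set \<Rightarrow> 'a edge set \<Rightarrow> ('a edge \<Rightarrow> int) \<Rightarrow> bool" where
  "closed_chain l V E b \<longleftrightarrow> (\<forall>x\<in>V. boundary E b x mod int l = 0)"

definition color_profile ::
    "nat \<Rightarrow> 'a set \<Rightarrow> 'a edge set \<Rightarrow> ('a edge \<Rightarrow> int) \<Rightarrow> 'a \<Rightarrow> int" where
  "color_profile l S E b = reduce l S (\<lambda>s. \<Sum>e\<in>{e\<in>E. color e = s}. b e)"

definition lin_comb ::
    "nat \<Rightarrow> 'a set \<Rightarrow> 'a edge set \<Rightarrow> ('a \<Rightarrow> int) \<Rightarrow> ('a \<Rightarrow> 'a edge \<Rightarrow> int) \<Rightarrow> 'a edge \<Rightarrow> int" where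
  "lin_comb l S E c b = (\<lambda>e\<in>E. (\<Sum>s\<in>S. c s * b s e) mod int l)"

definition is_solution ::
    "nat \<Rightarrow> nat \<Rightarrow> 'a set \<Rightarrow> (nat \<Rightarrow> 'a \<Rightarrow> int) \<Rightarrow> ('a \<Rightarrow> 'a edge \<Rightarrow> int) \<Rightarrow> bool" where
  "is_solution l g S A b \<longleftrightarrow>
     (let W = row_lattice_mod l g S A; V = Alb_verts l S W; E = Alb_edges l S W in
        (\<forall>s\<in>S. b s \<in> chains l E \<and> (\<forall>e\<in>E. color e \<noteq> s \<longrightarrow> b s e = 0)) \<and>
        (\<forall>c\<in>W. closed_chain l V E (lin_comb l S E c b)))"

text \<open>The class does not depend on the realizing matrix, so it makes no difference that
  \<open>A\<close> is quantified existentially.\<close>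

definition matroid_class :: "nat \<Rightarrow> 'a matroid set" where
  "matroid_class l =
     {R. regular_matroid R \<and>
        (\<exists>g A b. realizes g A R \<and> is_solution l g (ground R) A b \<and>
           (\<exists>c \<in> Fl l - {0}. \<forall>s\<in>ground R.
              color_profile l (ground R)
                (Alb_edges l (ground R) (row_lattice_mod l g (ground R) A)) (b s) s = c))}"

text \<open>On \<open>nat\<close>, \<open>Lcm {} = 1\<close>, and \<open>Lcm\<close> of an infinite set is \<open>0\<close>; a nonzero value
  therefore entails that the set of primes is finite.\<close>

definition radical_distance :: "'a matroid \<Rightarrow> nat" where
  "radical_distance R = Lcm {l. prime l \<and> R \<notin> matroid_class l}"

end

theory Submission
  imports Defs "HOL-Number_Theory.Cong"
begin

text \<open>A solution amounts to elements \<open>b\<^sub>s\<close> of the group algebra of \<open>V = F\<^sub>l\<^sup>S / U\<close> such that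
  the sum of \<open>c\<^sub>s (x\<^sub>s - 1) b\<^sub>s\<close> vanishes for all \<open>c \<in> U\<close>, where \<open>x\<^sub>s\<close> is the class of the unit
  vector \<open>e\<^sub>s\<close>; the color profile is the augmentation. The cuts of a complete bipartite graph are the
  matrices \<open>p\<^sub>i + q\<^sub>j\<close>, so there is one equation for each row and one for each column, and the classes
  of \<open>e\<^sub>a\<^sub>b\<close> with \<open>a, b \<ge> 1\<close> form a basis of \<open>V\<close>.

  For the graph \<open>K(3,5)\<close> these equations have a solution of augmentation 12 already in the integral
  group ring of \<open>Z\<^sup>S / U\<close>. Its reduction modulo \<open>l\<close> settles all primes other than 2 and 3.

  For \<open>l = 2, 3\<close> there is an obstruction. If \<open>F\<close> maps \<open>V\<close> to \<open>U\<close> and all the differences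
  \<open>F(v + e\<^sub>s)\<^sub>s - F(v)\<^sub>s = \<gamma>\<^sub>s\<close> are independent of \<open>v\<close>, then summation by parts shows that the
  sum of \<open>\<gamma>\<^sub>s \<lambda>\<^sub>s(b\<^sub>s)\<close> is zero. Polynomials of degree \<open>l\<close> provide such an \<open>F\<close> for which \<open>\<gamma>\<close> is the
  indicator function of a single edge. This applies to every realization, because two realizations
  have the same row lattice up to the signs of the columns.\<close>

section \<open>Linear systems and column matroids\<close>

text \<open>Gaussian elimination by induction on the equations: eliminating a pivot
  \<open>y0\<close> costs one equation and one unknown. It serves both the rank bound and matroid
  exchange.\<close>

lemma underdetermined_system_nontrivial_solution:
  fixes C :: "'i \<Rightarrow> 'b \<Rightarrow> 'a::field"
  assumes "finite I" "finite Y" "card I < card Y"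
  shows "\<exists>w. (\<exists>y\<in>Y. w y \<noteq> 0) \<and> (\<forall>i\<in>I. (\<Sum>y\<in>Y. w y * C i y) = 0)"
  using assms
proof (induction I arbitrary: Y C rule: finite_induct)
  case empty
  then have "Y \<noteq> {}" by auto
  then show ?case by (intro exI[of _ "\<lambda>_. 1"]) auto
next
  case (insert i I)
  show ?case
  proof (cases "\<forall>y\<in>Y. C i y = 0")
    case True
    have "card I < card Y" using insert by simp
    from insert.IH[OF \<open>finite Y\<close> this, of C] True show ?thesis by auto
  next
    case False
    then obtain y0 where y0: "y0 \<in> Y" "C i y0 \<noteq> 0" by auto
    have "card I < card (Y - {y0})" using insert y0 by simp
    \<comment> \<open>The new coefficients subtract the multiple of equation \<open>i\<close> that
      cancels \<open>y0\<close>. Below, \<open>- t\<close> is the value of \<open>y0\<close> forced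
      by equation \<open>i\<close>.\<close>
    from insert.IH[OF _ this, of "\<lambda>k y. C k y - C k y0 * C i y / C i y0"] insert.prems(1)
    obtain w where w: "\<exists>y\<in>Y - {y0}. w y \<noteq> 0"
      and eq: "\<And>k. k \<in> I \<Longrightarrow> (\<Sum>y\<in>Y - {y0}. w y * (C k y - C k y0 * C i y / C i y0)) = 0"
      by auto
    define t where "t = (\<Sum>y\<in>Y - {y0}. w y * C i y) / C i y0"
    define w' where "w' = w(y0 := - t)"
    have split: "(\<Sum>y\<in>Y. w' y * C k y) = - t * C k y0 + (\<Sum>y\<in>Y - {y0}. w y * C k y)" for k
      using insert.prems(1) y0(1) by (simp add: sum.remove[of _ y0] w'_def)
    have "(\<Sum>y\<in>Y. w' y * C i y) = 0"
      unfolding split t_def using y0 by simp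
    moreover have "(\<Sum>y\<in>Y. w' y * C k y) = 0" if "k \<in> I" for k
    proof -
      have "(\<Sum>y\<in>Y - {y0}. w y * (C k y - C k y0 * C i y / C i y0)) =
        (\<Sum>y\<in>Y - {y0}. w y * C k y) - (\<Sum>y\<in>Y - {y0}. w y * C i y) * C k y0 / C i y0"
        by (simp add: algebra_simps sum_subtractf sum_distrib_left sum_divide_distrib)
      then show ?thesis unfolding split using eq[OF that] by (simp add: t_def)
    qed
    moreover have "\<exists>y\<in>Y. w' y \<noteq> 0" using w y0 by (auto simp: w'_def)
    ultimately show ?thesis by auto
  qed
qed

lemma columns_independent_subset:
  assumes "columns_independent g A X" "Y \<subseteq> X" "finite X"
  shows "columns_independent g A Y"
  unfolding columns_independent_def
proof (intro allI impI ballI)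
  fix x :: "'a \<Rightarrow> rat" and s
  assume x: "\<forall>i<g. (\<Sum>s\<in>Y. x s * of_int (A i s)) = 0" and s: "s \<in> Y"
  define x' where "x' = (\<lambda>s. if s \<in> Y then x s else 0)"
  have "(\<Sum>s\<in>X. x' s * of_int (A i s)) = (\<Sum>s\<in>Y. x s * of_int (A i s))" for i
    by (rule sum.mono_neutral_cong_right) (use assms in \<open>auto simp: x'_def\<close>)
  then have "\<forall>s\<in>X. x' s = 0" using assms(1) x unfolding columns_independent_def by simp
  then have "x' s = 0" using s assms(2) by auto
  then show "x s = 0" using s by (simp add: x'_def)
qed

lemma columns_independent_insert:
  assumes ind: "columns_independent g A X" and fin: "finite X"
    and dep: "\<not> columns_independent g A (insert y X)"
  shows "\<exists>f :: 'a \<Rightarrow> rat. \<forall>i<g. of_int (A i y) = (\<Sum>s\<in>X. f s * of_int (A i s))"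
proof -
  have y: "y \<notin> X" using ind dep by (auto simp: insert_absorb)
  from dep obtain x :: "'a \<Rightarrow> rat" and s where
    x: "\<And>i. i < g \<Longrightarrow> (\<Sum>s\<in>insert y X. x s * of_int (A i s)) = 0" and s: "s \<in> insert y X" "x s \<noteq> 0"
    unfolding columns_independent_def by auto
  have x': "x y * of_int (A i y) + (\<Sum>s\<in>X. x s * of_int (A i s)) = 0" if "i < g" for i
    using x[OF that] fin y by simp
  have "x y \<noteq> 0"
  proof
    assume "x y = 0"
    then have "\<forall>s\<in>X. x s = 0" using x' ind unfolding columns_independent_def by auto
    then show False using s \<open>x y = 0\<close> by auto
  qed
  have "of_int (A i y) = (\<Sum>s\<in>X. - x s / x y * of_int (A i s))" if "i < g" for i
  proof -
    have "(\<Sum>s\<in>X. - x s / x y * of_int (A i s)) = - (\<Sum>s\<in>X. x s * of_int (A i s)) / x y"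
      by (simp add: sum_divide_distrib sum_negf)
    also have "\<dots> = of_int (A i y)"
      using x'[OF that] \<open>x y \<noteq> 0\<close> by (simp add: divide_simps) (simp add: algebra_simps)
    finally show ?thesis by simp
  qed
  then show ?thesis by (intro exI[of _ "\<lambda>s. - x s / x y"]) auto
qed

lemma card_le_rank_if_columns_independent:
  assumes "columns_independent g A X" "finite X"
  shows "card X \<le> g"
proof (rule ccontr)
  assume "\<not> card X \<le> g"
  then have "card {..<g} < card X" by simp
  from underdetermined_system_nontrivial_solution[OF _ assms(2) this, of "\<lambda>i s. of_int (A i s) :: rat"]
  show False using assms(1) unfolding columns_independent_def by auto
qed

text \<open>Steinitz exchange: if no element of \<open>Y\<close> extended \<open>X\<close>, every
  column of \<open>Y\<close> would be a combination of the fewer columns of \<open>X\<close>. A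
  kernel vector of the coefficients \<open>f\<close> would then be a dependency in
  \<open>Y\<close>.\<close>

lemma is_matroid_if_columns:
  assumes fin: "finite (ground M)"
    and ind: "\<And>X. X \<in> indep M \<longleftrightarrow> X \<subseteq> ground M \<and> columns_independent g A X"
  shows "is_matroid M"
  unfolding is_matroid_def
proof (intro conjI allI impI)
  show "{} \<in> indep M" unfolding ind columns_independent_def by simp
  show "indep M \<subseteq> Pow (ground M)" using ind by auto
  show "Y \<in> indep M" if "X \<in> indep M" "Y \<subseteq> X" for X Y
    using that columns_independent_subset[of g A X Y] finite_subset[OF _ fin, of X] unfolding ind by auto
  fix X Y assume X: "X \<in> indep M" and Y: "Y \<in> indep M" and card: "card X < card Y"
  have finX: "finite X" and finY: "finite Y" using X Y finite_subset[OF _ fin] unfolding ind by auto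
  show "\<exists>y\<in>Y - X. insert y X \<in> indep M"
  proof (rule ccontr)
    assume none: "\<not> ?thesis"
    have "\<exists>f :: 'a \<Rightarrow> rat. \<forall>i<g. of_int (A i y) = (\<Sum>s\<in>X. f s * of_int (A i s))" if "y \<in> Y" for y
    proof (cases "y \<in> X")
      case True
      have "(\<Sum>s\<in>X. of_bool (s = y) * of_int (A i s)) = (of_int (A i y) :: rat)" for i
        using True finX by (simp add: of_bool_def if_distrib[of "\<lambda>u. u * _"] cong: if_cong)
      then show ?thesis by (intro exI[of _ "\<lambda>s. of_bool (s = y)"]) simp
    next
      case False
      then have "\<not> columns_independent g A (insert y X)"
        using none that X Y unfolding ind by auto
      then show ?thesis using columns_independent_insert[of g A X y] X finX unfolding ind by simp
    qed
    then obtain f :: "'a \<Rightarrow> 'a \<Rightarrow> rat" where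
      f: "\<And>y i. y \<in> Y \<Longrightarrow> i < g \<Longrightarrow> of_int (A i y) = (\<Sum>s\<in>X. f y s * of_int (A i s))"
      by metis
    from underdetermined_system_nontrivial_solution[OF finX finY card, of "\<lambda>s y. f y s"]
    obtain w where w: "\<exists>y\<in>Y. w y \<noteq> 0" and eq: "\<And>s. s \<in> X \<Longrightarrow> (\<Sum>y\<in>Y. w y * f y s) = 0"
      by auto
    have "(\<Sum>y\<in>Y. w y * of_int (A i y)) = 0" if "i < g" for i
    proof -
      have "(\<Sum>y\<in>Y. w y * of_int (A i y)) = (\<Sum>y\<in>Y. \<Sum>s\<in>X. w y * f y s * of_int (A i s))"
        using f that by (auto simp: sum_distrib_left mult.assoc intro!: sum.cong)
      also have "\<dots> = (\<Sum>s\<in>X. (\<Sum>y\<in>Y. w y * f y s) * of_int (A i s))"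
        by (subst sum.swap) (simp add: sum_distrib_right)
      finally show ?thesis using eq by simp
    qed
    then show False using w Y unfolding ind columns_independent_def by blast
  qed
qed (use fin in auto)

section \<open>Cycles in bipartite graphs\<close>

text \<open>The first vertex \<open>a\<close> of a longest path has a second neighbour
  \<open>w\<close>. Maximality forces \<open>w\<close> onto the path, where it closes a
  cycle.\<close>

lemma ex_cycle_if_min_degree_two:
  assumes fin: "finite F" and ne: "F \<noteq> {}" and two: "\<And>e. e \<in> F \<Longrightarrow> card e = 2"
    and deg: "\<And>e v. e \<in> F \<Longrightarrow> v \<in> e \<Longrightarrow> \<exists>e'\<in>F. e' \<noteq> e \<and> v \<in> e'"
  shows "\<exists>p. is_cycle F p"
proof -
  define path where "path p \<longleftrightarrow> 2 \<le> length p \<and> distinct p \<and>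
    (\<forall>i. Suc i < length p \<longrightarrow> {p ! i, p ! Suc i} \<in> F)" for p
  have finV: "finite (\<Union>F)"
    using fin two by (metis card.infinite finite_Union zero_neq_numeral)
  have bound: "length p < Suc (card (\<Union>F))" if "path p" for p
  proof -
    have "set p \<subseteq> \<Union>F"
    proof
      fix v assume "v \<in> set p"
      then obtain i where i: "i < length p" "p ! i = v" by (auto simp: in_set_conv_nth)
      show "v \<in> \<Union>F"
      proof (cases "Suc i < length p")
        case True
        then show ?thesis using that i unfolding path_def by blast
      next
        case False
        then have "i \<noteq> 0" using that unfolding path_def by auto
        then obtain i' where "i = Suc i'" by (cases i) auto
        then show ?thesis using that i unfolding path_def by blast
      qed
    qed
    then have "card (set p) \<le> card (\<Union>F)" by (rule card_mono[OF finV])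
    moreover have "card (set p) = length p" using that distinct_card unfolding path_def by blast
    ultimately show ?thesis by simp
  qed
  obtain e where e: "e \<in> F" using ne by auto
  then obtain u v where uv: "e = {u, v}" "u \<noteq> v" using two card_2_iff by metis
  have "path [u, v]" using e uv by (auto simp: path_def less_Suc_eq)
  from ex_has_greatest_nat[of path, OF this, of length] bound
  obtain p where p: "path p" and longest: "\<And>q. path q \<Longrightarrow> length q \<le> length p" by blast
  then obtain a b q where pq: "p = a # b # q"
    by (auto simp: path_def numeral_2_eq_2 Suc_le_length_iff)
  have ab: "{a, b} \<in> F" using p unfolding path_def pq by force
  from deg[OF ab, of a] obtain e' where e': "e' \<in> F" "e' \<noteq> {a, b}" "a \<in> e'" by auto
  then obtain w where w: "e' = {a, w}" "w \<noteq> a" using two[of e'] card_2_iff[of e'] by auto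
  have wb: "w \<noteq> b" using e' w by auto
  have "w \<in> set p"
  proof (rule ccontr)
    assume "w \<notin> set p"
    then have "path (w # p)"
      using p e' w unfolding path_def by (auto simp: pq nth_Cons insert_commute split: nat.splits)
    then show False using longest by fastforce
  qed
  then obtain k where k: "k < length p" "p ! k = w" by (auto simp: in_set_conv_nth)
  \<comment> \<open>As \<open>w\<close> is neither of the first two vertices, the closed segment has
    the three vertices that \<open>is_cycle\<close> demands.\<close>
  have k2: "2 \<le> k"
  proof (rule ccontr)
    assume "\<not> 2 \<le> k"
    then have "k = 0 \<or> k = 1" by auto
    then show False using k(2) w wb unfolding pq by auto
  qed
  have "is_cycle F (take (Suc k) p)"
    unfolding is_cycle_def
  proof (intro conjI allI impI)
    show "3 \<le> length (take (Suc k) p)" using k k2 by simp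
    show "distinct (take (Suc k) p)" using p unfolding path_def by simp
    fix i assume "i < length (take (Suc k) p)"
    then have i: "i \<le> k" using k by simp
    show "{take (Suc k) p ! i, take (Suc k) p ! (Suc i mod length (take (Suc k) p))} \<in> F"
    proof (cases "i = k")
      case True
      moreover have "length (take (Suc k) p) = Suc k" "p ! 0 = a" using k by (simp_all add: pq)
      ultimately show ?thesis using k e' w by (simp add: insert_commute)
    next
      case False
      then show ?thesis using i k p unfolding path_def by simp
    qed
  qed
  then show ?thesis by (rule exI)
qed

abbreviation bip_edge :: "nat \<Rightarrow> nat \<Rightarrow> (nat + nat) set" where
  "bip_edge i j \<equiv> {Inl i, Inr j}"

definition bip_edges :: "nat \<Rightarrow> nat \<Rightarrow> (nat + nat) set set" where
  "bip_edges m n = {bip_edge i j | i j. i < m \<and> j < n}"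

lemma bip_edges_image: "bip_edges m n = (\<lambda>(i, j). bip_edge i j) ` ({..<m} \<times> {..<n})"
  by (auto simp: bip_edges_def)

lemma finite_bip_edges [simp]: "finite (bip_edges m n)"
  unfolding bip_edges_image by simp

lemma bip_edge_eq_iff [simp]: "bip_edge i j = bip_edge i' j' \<longleftrightarrow> i = i' \<and> j = j'"
  by (auto simp: doubleton_eq_iff)

lemma bip_edge_mem [simp]: "bip_edge i j \<in> bip_edges m n \<longleftrightarrow> i < m \<and> j < n"
  by (auto simp: bip_edges_def)

lemma sum_bip_edges: "(\<Sum>s\<in>bip_edges m n. h s) = (\<Sum>i<m. \<Sum>j<n. h (bip_edge i j))"
proof -
  have "(\<Sum>s\<in>bip_edges m n. h s) = (\<Sum>(i, j)\<in>{..<m} \<times> {..<n}. h (bip_edge i j))"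
    unfolding bip_edges_image by (subst sum.reindex) (auto simp: inj_on_def split_beta)
  then show ?thesis by (simp add: sum.cartesian_product)
qed

lemma ground_cycle_matroid_bip: "ground (cycle_matroid (complete_bipartite m n)) = bip_edges m n"
  by (simp add: cycle_matroid_def complete_bipartite_def bip_edges_def)

text \<open>Rational independence of the unsigned incidence vectors. In a bipartite graph, negating
  the coordinates of one side gives the oriented incidence matrix, so this describes the cycle
  matroid. It mediates between cycles, \<open>cut_matrix\<close> and arbitrary realizations.\<close>

definition star_independent :: "'v set set \<Rightarrow> bool" where
  "star_independent X \<longleftrightarrow>
     (\<forall>x :: 'v set \<Rightarrow> rat. (\<forall>v. (\<Sum>s\<in>X. x s * of_bool (v \<in> s)) = 0) \<longrightarrow> (\<forall>s\<in>X. x s = 0))"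

text \<open>On a bipartite graph the vertices of a cycle can be signed so that the signs
  alternate, whatever the starting point; this replaces an argument on the parity of its length.\<close>

lemma not_star_independent_if_cycle:
  assumes X: "X \<subseteq> bip_edges m n" and cyc: "is_cycle X p"
  shows "\<not> star_independent X"
proof
  assume ind: "star_independent X"
  have finX: "finite X" using finite_subset[OF X] by simp
  define L where "L = length p"
  define E where "E t = {p ! t, p ! (Suc t mod L)}" for t
  have L: "3 \<le> L" and dist: "distinct p" and E: "\<And>t. t < L \<Longrightarrow> E t \<in> X"
    using cyc unfolding is_cycle_def L_def E_def by auto
  define sg :: "nat + nat \<Rightarrow> rat" where "sg u = (case u of Inl _ \<Rightarrow> 1 | Inr _ \<Rightarrow> - 1)" for u
  have alt: "sg (p ! (Suc t mod L)) = - sg (p ! t)" if "t < L" for t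
  proof -
    have "E t \<in> bip_edges m n" using E[OF that] X by auto
    then show ?thesis by (auto simp: E_def bip_edges_def doubleton_eq_iff sg_def)
  qed
  \<comment> \<open>A dependency with alternating signs along the cycle; at each vertex the
    contributions telescope through \<open>h\<close>.\<close>
  define x where "x s = (\<Sum>t<L. sg (p ! t) * of_bool (s = E t))" for s
  have "(\<Sum>s\<in>X. x s * of_bool (v \<in> s)) = 0" for v
  proof -
    define h where "h u = sg u * of_bool (v = u)" for u
    have "(\<Sum>s\<in>X. x s * of_bool (v \<in> s)) = (\<Sum>t<L. \<Sum>s\<in>X. sg (p ! t) * of_bool (s = E t) * of_bool (v \<in> s))"
      unfolding x_def sum_distrib_right by (rule sum.swap)
    also have "\<dots> = (\<Sum>t<L. sg (p ! t) * of_bool (v \<in> E t))"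
    proof (rule sum.cong[OF refl])
      fix t assume "t \<in> {..<L}"
      then have "E t \<in> X" using E by simp
      then show "(\<Sum>s\<in>X. sg (p ! t) * of_bool (s = E t) * of_bool (v \<in> s)) = sg (p ! t) * of_bool (v \<in> E t)"
        using finX by (subst sum.remove[of _ "E t"]) auto
    qed
    also have "\<dots> = (\<Sum>t<L. h (p ! t) - h (p ! (Suc t mod L)))"
    proof (rule sum.cong[OF refl])
      fix t assume "t \<in> {..<L}"
      then have t: "t < L" by simp
      have "p ! t \<noteq> p ! (Suc t mod L)"
        using alt[OF t] by (auto simp: sg_def split: sum.splits)
      then show "sg (p ! t) * of_bool (v \<in> E t) = h (p ! t) - h (p ! (Suc t mod L))"
        using alt[OF t] by (auto simp: h_def E_def)
    qed
    also have "\<dots> = 0"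
    proof -
      obtain L' where L': "L = Suc L'" using L by (cases L) auto
      have "(\<Sum>t<L. h (p ! (Suc t mod L))) = (\<Sum>t<L'. h (p ! Suc t)) + h (p ! 0)"
        unfolding L' by (auto intro!: sum.cong)
      also have "\<dots> = (\<Sum>t<L. h (p ! t))"
        unfolding L' by (subst sum.lessThan_Suc_shift) simp
      finally show ?thesis by (simp add: sum_subtractf)
    qed
    finally show ?thesis .
  qed
  then have "x (E 0) = 0" using ind E[of 0] L unfolding star_independent_def by auto
  moreover have "x (E 0) = sg (p ! 0)"
  proof -
    \<comment> \<open>Length at least 3 enters here: the two edges of a closed walk of length 2
      coincide and their signs cancel.\<close>
    have "E 0 \<noteq> E t" if "t < L" "t \<noteq> 0" for t
    proof
      assume eq: "E 0 = E t"
      have neq: "p ! a \<noteq> p ! b" if "a < L" "b < L" "a \<noteq> b" for a b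
        using that dist unfolding L_def by (simp add: nth_eq_iff_index_eq)
      have "p ! t = p ! 1" "p ! 0 = p ! (Suc t mod L)"
        using eq neq[of 0 t] that L unfolding E_def by (auto simp: doubleton_eq_iff)
      then have t1: "t = 1" using neq[of t 1] that L by auto
      then have "Suc t mod L = 2" using L by simp
      then show False using \<open>p ! 0 = p ! (Suc t mod L)\<close> neq[of 0 2] L by simp
    qed
    then show ?thesis unfolding x_def using L by (subst sum.remove[of _ 0]) auto
  qed
  moreover have "sg (p ! 0) \<noteq> 0" by (simp add: sg_def split: sum.splits)
  ultimately show False by simp
qed

text \<open>A vertex on only one edge of the support of a dependency would force that coefficient to
  be zero, so the support has minimum degree two.\<close>

lemma ex_cycle_if_not_star_independent:
  assumes X: "X \<subseteq> bip_edges m n" and dep: "\<not> star_independent X"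
  shows "\<exists>p. is_cycle X p"
proof -
  have finX: "finite X" using finite_subset[OF X] by simp
  from dep obtain x :: "(nat + nat) set \<Rightarrow> rat" and s0
    where x: "\<And>v. (\<Sum>s\<in>X. x s * of_bool (v \<in> s)) = 0" and s0: "s0 \<in> X" "x s0 \<noteq> 0"
    unfolding star_independent_def by auto
  define F where "F = {s \<in> X. x s \<noteq> 0}"
  have "\<exists>p. is_cycle F p"
  proof (rule ex_cycle_if_min_degree_two)
    show "finite F" "F \<noteq> {}" using finX s0 by (auto simp: F_def)
    show "card e = 2" if "e \<in> F" for e using that X by (auto simp: F_def bip_edges_def)
    fix e v assume e: "e \<in> F" "v \<in> e"
    show "\<exists>e'\<in>F. e' \<noteq> e \<and> v \<in> e'"
    proof (rule ccontr)
      assume "\<not> ?thesis"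
      then have rest: "(\<Sum>s\<in>X - {e}. x s * of_bool (v \<in> s)) = 0"
        by (intro sum.neutral) (auto simp: F_def)
      have "e \<in> X" using e by (simp add: F_def)
      then have "x e * of_bool (v \<in> e) = 0"
        using x[of v] sum.remove[OF finX, of e "\<lambda>s. x s * of_bool (v \<in> s)"] rest by simp
      then have "x e = 0" using e by simp
      then show False using e by (simp add: F_def)
    qed
  qed
  then show ?thesis unfolding is_cycle_def F_def by blast
qed

lemma indep_cycle_matroid_bip:
  "X \<in> indep (cycle_matroid (complete_bipartite m n)) \<longleftrightarrow> X \<subseteq> bip_edges m n \<and> star_independent X"
  using not_star_independent_if_cycle[of X m n] ex_cycle_if_not_star_independent[of X m n]
  by (auto simp: cycle_matroid_def complete_bipartite_def bip_edges_def[symmetric])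

section \<open>Fundamental cuts\<close>

text \<open>The rows are the fundamental cuts of the spanning tree of all edges at
  \<open>Inl 0\<close> or \<open>Inr 0\<close>. Row 0 belongs to the edge joining these two
  vertices, hence its entries \<open>-1\<close> on edges avoiding both. The other rows are stars,
  with row \<open>m\<close> belonging to \<open>Inr 1\<close>.\<close>

definition cut_matrix :: "nat \<Rightarrow> nat \<Rightarrow> (nat + nat) set \<Rightarrow> int" where
  "cut_matrix m k s =
     (if k = 0 then of_bool (Inl 0 \<in> s) + of_bool (Inr 0 \<in> s) - 1
      else if k < m then of_bool (Inl k \<in> s)
      else of_bool (Inr (k - m + 1) \<in> s))"

lemma sum_stars_bip:
  fixes x :: "(nat + nat) set \<Rightarrow> 'a::comm_semiring_1"
  assumes "X \<subseteq> bip_edges m n"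
  shows "(\<Sum>i<m. \<Sum>s\<in>X. x s * of_bool (Inl i \<in> s)) = sum x X"
    and "(\<Sum>j<n. \<Sum>s\<in>X. x s * of_bool (Inr j \<in> s)) = sum x X"
proof -
  have "(\<Sum>i<m. x s * of_bool (Inl i \<in> s)) = x s \<and> (\<Sum>j<n. x s * of_bool (Inr j \<in> s)) = x s"
    if s: "s \<in> X" for s
  proof -
    obtain i0 j0 where ij: "s = bip_edge i0 j0" "i0 < m" "j0 < n"
      using assms s by (auto simp: bip_edges_def)
    have "(\<Sum>i<m. x s * of_bool (Inl i \<in> s)) = (\<Sum>i<m. if i = i0 then x s else 0)"
      and "(\<Sum>j<n. x s * of_bool (Inr j \<in> s)) = (\<Sum>j<n. if j = j0 then x s else 0)"
      by (auto intro!: sum.cong simp: ij(1))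
    then show ?thesis using ij by simp
  qed
  then show "(\<Sum>i<m. \<Sum>s\<in>X. x s * of_bool (Inl i \<in> s)) = sum x X"
    and "(\<Sum>j<n. \<Sum>s\<in>X. x s * of_bool (Inr j \<in> s)) = sum x X"
    by (subst sum.swap, simp)+
qed

text \<open>The star sums of either side add up to \<open>sum x X\<close>. If they vanish except at
  \<open>Inl 0\<close> and \<open>Inr 0\<close>, both of these equal the total, and row 0 makes it
  zero.\<close>

lemma cut_matrix_columns_independent_iff:
  assumes X: "X \<subseteq> bip_edges m n" and mn: "0 < m" "0 < n"
  shows "columns_independent (m + n - 1) (cut_matrix m) X \<longleftrightarrow> star_independent X"
proof -
  have "(\<forall>k < m + n - 1. (\<Sum>s\<in>X. x s * of_int (cut_matrix m k s)) = 0) \<longleftrightarrow>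
        (\<forall>v. (\<Sum>s\<in>X. x s * of_bool (v \<in> s)) = 0)" for x :: "(nat + nat) set \<Rightarrow> rat"
  proof -
    define \<rho> where "\<rho> i = (\<Sum>s\<in>X. x s * of_bool (Inl i \<in> s))" for i
    define \<kappa> where "\<kappa> j = (\<Sum>s\<in>X. x s * of_bool (Inr j \<in> s))" for j
    have sums: "sum \<rho> {..<m} = sum x X" "sum \<kappa> {..<n} = sum x X"
      using sum_stars_bip[OF X, of x] by (simp_all add: \<rho>_def \<kappa>_def)
    have row0: "(\<Sum>s\<in>X. x s * of_int (cut_matrix m 0 s)) = \<rho> 0 + \<kappa> 0 - sum x X"
      by (simp add: cut_matrix_def \<rho>_def \<kappa>_def algebra_simps sum.distrib sum_subtractf del: sum_mult_of_bool_eq)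
    have rowl: "(\<Sum>s\<in>X. x s * of_int (cut_matrix m k s)) = \<rho> k" if "0 < k" "k < m" for k
      using that by (simp add: cut_matrix_def \<rho>_def del: sum_mult_of_bool_eq)
    have rowr: "(\<Sum>s\<in>X. x s * of_int (cut_matrix m (m + j) s)) = \<kappa> (Suc j)" for j
      using mn by (simp add: cut_matrix_def \<kappa>_def del: sum_mult_of_bool_eq)
    have outl: "\<rho> i = 0" if "\<not> i < m" for i
      unfolding \<rho>_def using that X by (intro sum.neutral) (auto simp: bip_edges_def)
    have outr: "\<kappa> j = 0" if "\<not> j < n" for j
      unfolding \<kappa>_def using that X by (intro sum.neutral) (auto simp: bip_edges_def)
    have all_iff: "(\<forall>v. (\<Sum>s\<in>X. x s * of_bool (v \<in> s)) = 0) \<longleftrightarrow> (\<forall>i. \<rho> i = 0) \<and> (\<forall>j. \<kappa> j = 0)"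
      unfolding \<rho>_def \<kappa>_def by (metis sum.exhaust)
    show ?thesis
    proof
      assume L: "\<forall>k < m + n - 1. (\<Sum>s\<in>X. x s * of_int (cut_matrix m k s)) = 0"
      have \<rho>: "\<rho> i = 0" if "i \<noteq> 0" for i
        using L rowl[of i] outl[of i] that mn by (cases "i < m") auto
      have \<kappa>: "\<kappa> j = 0" if j: "j \<noteq> 0" for j
      proof (cases "j < n")
        case True
        obtain j' where "j = Suc j'" using j by (cases j) auto
        then show ?thesis using L rowr[of j'] True by auto
      qed (rule outr)
      have "sum \<rho> {..<m} = \<rho> 0" "sum \<kappa> {..<n} = \<kappa> 0"
        using mn \<rho> \<kappa> by (subst sum.remove[of _ 0]; simp)+
      moreover have "\<rho> 0 + \<kappa> 0 - sum x X = 0" using L row0 mn by auto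
      ultimately have "\<rho> 0 = 0" "\<kappa> 0 = 0" using sums by auto
      then show "\<forall>v. (\<Sum>s\<in>X. x s * of_bool (v \<in> s)) = 0"
        unfolding all_iff using \<rho> \<kappa> by metis
    next
      assume "\<forall>v. (\<Sum>s\<in>X. x s * of_bool (v \<in> s)) = 0"
      then have z: "\<rho> i = 0" "\<kappa> j = 0" for i j unfolding all_iff by auto
      then have "sum x X = 0" using sums by simp
      show "\<forall>k < m + n - 1. (\<Sum>s\<in>X. x s * of_int (cut_matrix m k s)) = 0"
      proof (intro allI impI)
        fix k
        consider "k = 0" | "0 < k" "k < m" | j where "k = m + j"
          by (metis le_add_diff_inverse not_less neq0_conv)
        then show "(\<Sum>s\<in>X. x s * of_int (cut_matrix m k s)) = 0"
          by cases (use row0 rowl rowr z \<open>sum x X = 0\<close> in auto)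
      qed
    qed
  qed
  then show ?thesis unfolding columns_independent_def star_independent_def by simp
qed

lemma standard_form_cut_matrix:
  assumes "0 < m" "0 < n"
  shows "standard_form (m + n - 1) (bip_edges m n) (cut_matrix m)"
  unfolding standard_form_def
proof (intro exI conjI allI impI)
  let ?\<beta> = "\<lambda>k. if k < m then bip_edge k 0 else bip_edge 0 (k - m + 1)"
  show "?\<beta> \<in> {..<m + n - 1} \<rightarrow> bip_edges m n" using assms by auto
  show "inj_on ?\<beta> {..<m + n - 1}" by (auto simp: inj_on_def split: if_splits)
  show "cut_matrix m i (?\<beta> j) = (if i = j then 1 else 0)" for i j
    using assms by (auto simp: cut_matrix_def)
qed

text \<open>Expand along a column with at most one nonzero entry. If there is none, every column has
  exactly one \<open>1\<close> and one \<open>-1\<close>, so the rows add up to zero.\<close>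

lemma det_network_matrix:
  fixes N :: "int mat"
  assumes "N \<in> carrier_mat k k"
    and "\<And>a b. a < k \<Longrightarrow> b < k \<Longrightarrow> N $$ (a, b) \<in> {-1, 0, 1}"
    and "\<And>a a' b. a < k \<Longrightarrow> a' < k \<Longrightarrow> b < k \<Longrightarrow> a \<noteq> a' \<Longrightarrow>
           N $$ (a, b) \<noteq> 0 \<Longrightarrow> N $$ (a', b) \<noteq> 0 \<Longrightarrow> N $$ (a, b) + N $$ (a', b) = 0"
  shows "det N \<in> {-1, 0, 1}"
  using assms
proof (induction k arbitrary: N)
  case 0
  then show ?case by simp
next
  case (Suc k)
  note N = Suc.prems(1)
  show ?case
  proof (cases "\<exists>b < Suc k. \<exists>a0 < Suc k. \<forall>a < Suc k. a \<noteq> a0 \<longrightarrow> N $$ (a, b) = 0")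
    case True
    then obtain a0 b where b: "b < Suc k" and a0: "a0 < Suc k"
      and zero: "\<And>a. a < Suc k \<Longrightarrow> a \<noteq> a0 \<Longrightarrow> N $$ (a, b) = 0" by auto
    have "det N = (\<Sum>a<Suc k. N $$ (a, b) * cofactor N a b)"
      by (rule laplace_expansion_column[OF N b])
    also have "\<dots> = N $$ (a0, b) * cofactor N a0 b"
      using a0 zero by (subst sum.remove[of _ a0]) (auto intro!: sum.neutral)
    finally have det: "det N = N $$ (a0, b) * ((-1) ^ (a0 + b) * det (mat_delete N a0 b))"
      unfolding cofactor_def .
    have idx: "mat_delete N a0 b $$ (a, c) = N $$ (insert_index a0 a, insert_index b c)"
      if "a < k" "c < k" for a c
      using mat_delete_index[OF N a0 b that] by simp
    have "det (mat_delete N a0 b) \<in> {-1, 0, 1}"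
    proof (rule Suc.IH)
      show "mat_delete N a0 b \<in> carrier_mat k k" using mat_delete_carrier[OF N] by simp
      show "mat_delete N a0 b $$ (a, c) \<in> {-1, 0, 1}" if "a < k" "c < k" for a c
        unfolding idx[OF that] by (rule Suc.prems(2)) (use that in \<open>auto simp: insert_index_def\<close>)
      show "mat_delete N a0 b $$ (a, c) + mat_delete N a0 b $$ (a', c) = 0"
        if "a < k" "a' < k" "c < k" "a \<noteq> a'"
          "mat_delete N a0 b $$ (a, c) \<noteq> 0" "mat_delete N a0 b $$ (a', c) \<noteq> 0" for a a' c
        using that(5,6) unfolding idx[OF that(1,3)] idx[OF that(2,3)]
        by (intro Suc.prems(3)) (use that in \<open>auto simp: insert_index_def\<close>)
    qed
    moreover have "N $$ (a0, b) \<in> {-1, 0, 1}" by (rule Suc.prems(2)[OF a0 b])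
    moreover have "(-1) ^ (a0 + b) \<in> {-1, 1 :: int}" by (cases "even (a0 + b)") auto
    ultimately show ?thesis unfolding det by auto
  next
    case False
    have col: "(\<Sum>a<Suc k. N $$ (a, b)) = 0" if b: "b < Suc k" for b
    proof -
      from False b obtain a where a: "a < Suc k" "N $$ (a, b) \<noteq> 0" by (metis zero_less_Suc)
      with False b obtain a' where a': "a' < Suc k" "a' \<noteq> a" "N $$ (a', b) \<noteq> 0" by metis
      have sum0: "N $$ (a, b) + N $$ (a', b) = 0"
        using Suc.prems(3)[OF a(1) a'(1) b] a a' by auto
      have "N $$ (c, b) = 0" if "c < Suc k" "c \<noteq> a" "c \<noteq> a'" for c
      proof (rule ccontr)
        assume "N $$ (c, b) \<noteq> 0"
        then have "N $$ (a, b) + N $$ (c, b) = 0" "N $$ (a', b) + N $$ (c, b) = 0"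
          using Suc.prems(3)[OF a(1) that(1) b] Suc.prems(3)[OF a'(1) that(1) b] a a' that by auto
        then show False using sum0 a by simp
      qed
      then have "(\<Sum>a<Suc k. N $$ (a, b)) = (\<Sum>c\<in>{a, a'}. N $$ (c, b))"
        using a a' by (intro sum.mono_neutral_right) auto
      then show ?thesis using sum0 a' by simp
    qed
    have "det N\<^sup>T = 0"
    proof (subst det_0_iff_vec_prod_zero)
      show "N\<^sup>T \<in> carrier_mat (Suc k) (Suc k)" using N by simp
      let ?v = "vec (Suc k) (\<lambda>_. 1 :: int)"
      have "N\<^sup>T *\<^sub>v ?v = 0\<^sub>v (Suc k)"
      proof (rule eq_vecI)
        fix b assume "b < dim_vec (0\<^sub>v (Suc k) :: int vec)"
        then have b: "b < Suc k" by simp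
        then have "(N\<^sup>T *\<^sub>v ?v) $ b = (\<Sum>a = 0..<Suc k. N $$ (a, b))"
          using N by (auto simp: scalar_prod_def intro!: sum.cong)
        then show "(N\<^sup>T *\<^sub>v ?v) $ b = 0\<^sub>v (Suc k) $ b"
          using col[OF b] b by (simp add: atLeast0LessThan)
      qed (use N in simp)
      moreover have "?v \<noteq> 0\<^sub>v (Suc k)"
        by (metis index_vec index_zero_vec(1) zero_less_Suc zero_neq_one)
      ultimately show "\<exists>v. v \<in> carrier_vec (Suc k) \<and> v \<noteq> 0\<^sub>v (Suc k) \<and> N\<^sup>T *\<^sub>v v = 0\<^sub>v (Suc k)"
        by (intro exI[of _ ?v]) simp
    qed
    then show ?thesis using det_transpose[OF N] by simp
  qed
qed

lemma det_involution_mult: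
  fixes P M :: "int mat"
  assumes P: "P \<in> carrier_mat k k" and M: "M \<in> carrier_mat k k" and inv: "P * P = 1\<^sub>m k"
    and PM: "det (P * M) \<in> {-1, 0, 1}"
  shows "det M \<in> {-1, 0, 1}"
proof -
  have "det P * det P = 1" using det_mult[OF P P] inv by simp
  then have "det P = 1 \<or> det P = -1" using square_eq_1_iff by blast
  then show ?thesis using PM det_mult[OF P M] by auto
qed

text \<open>Adding the rows of the left vertices to row \<open>0\<close> and changing their signs turns every
  square submatrix into one whose columns have at most one entry \<open>1\<close> and at most one \<open>-1\<close>.\<close>

lemma totally_unimodular_cut_matrix:
  assumes mn: "0 < m" "0 < n"
  shows "totally_unimodular (m + n - 1) (bip_edges m n) (cut_matrix m)"
  unfolding totally_unimodular_def
proof (intro allI impI)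
  fix k and r :: "nat \<Rightarrow> nat" and q
  assume injr: "inj_on r {..<k}" and q: "q \<in> {..<k} \<rightarrow> bip_edges m n"
  define left where "left a \<longleftrightarrow> 0 < r a \<and> r a < m" for a
  define P :: "int mat" where "P = mat k k (\<lambda>(a, a').
    if a = a' then if left a then -1 else 1 else of_bool (r a = 0 \<and> left a'))"
  define M where "M = mat k k (\<lambda>(a, b). cut_matrix m (r a) (q b))"
  have P: "P \<in> carrier_mat k k" and M: "M \<in> carrier_mat k k" by (simp_all add: P_def M_def)
  have req: "a = a'" if "r a = r a'" "a < k" "a' < k" for a a'
    using injr that by (auto simp: inj_on_def)
  have mult: "(P * B) $$ (a, b) = (if r a = 0 then B $$ (a, b) + (\<Sum>a'<k. of_bool (left a') * B $$ (a', b))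
      else (if left a then -1 else 1) * B $$ (a, b))"
    if B: "B \<in> carrier_mat k k" and ab: "a < k" "b < k" for B a b
  proof -
    have "(P * B) $$ (a, b) = (\<Sum>a'<k. P $$ (a, a') * B $$ (a', b))"
      using B P ab by (auto simp: scalar_prod_def atLeast0LessThan intro!: sum.cong)
    also have "\<dots> = (\<Sum>a'<k. (if a' = a then (if left a then -1 else 1) * B $$ (a, b) else 0)
        + (if r a = 0 then of_bool (left a') * B $$ (a', b) else 0))"
      using ab by (intro sum.cong) (auto simp: P_def left_def)
    also have "\<dots> = (if left a then -1 else 1) * B $$ (a, b)
        + (if r a = 0 then (\<Sum>a'<k. of_bool (left a') * B $$ (a', b)) else 0)"
      using ab by (simp add: sum.distrib)
    finally show ?thesis by (simp add: left_def)
  qed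
  have "det M \<in> {-1, 0, 1}"
  proof (rule det_involution_mult[OF P M])
    show "P * P = 1\<^sub>m k"
    proof (rule eq_matI)
      fix a b assume "a < dim_row (1\<^sub>m k :: int mat)" "b < dim_col (1\<^sub>m k :: int mat)"
      then have ab: "a < k" "b < k" by auto
      have "(\<Sum>a'<k. of_bool (left a') * P $$ (a', b)) = (\<Sum>a'<k. if a' = b then - of_bool (left b) else 0)"
        using ab by (intro sum.cong) (auto simp: P_def left_def)
      then have "(\<Sum>a'<k. of_bool (left a') * P $$ (a', b)) = - of_bool (left b)"
        using ab by simp
      then show "(P * P) $$ (a, b) = 1\<^sub>m k $$ (a, b)"
        unfolding mult[OF P ab] using ab by (auto simp: P_def left_def)
    qed (use P in auto)
    have "\<exists>i j. q b = bip_edge i j" if "b < k" for b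
    proof -
      have "q b \<in> bip_edges m n" using q that by auto
      then show ?thesis by (auto simp: bip_edges_def)
    qed
    then obtain ii jj where ij: "\<And>b. b < k \<Longrightarrow> q b = bip_edge (ii b) (jj b)" by metis
    \<comment> \<open>The chosen rows may omit the star of the left endpoint. \<open>hit b\<close>
      records its presence; injectivity of \<open>r\<close> lets it count only once, and
      \<open>left\<close> excludes the endpoint 0.\<close>
    define hit where "hit b \<longleftrightarrow> (\<exists>a<k. left a \<and> r a = ii b)" for b
    have hits: "(\<Sum>a'<k. of_bool (left a') * M $$ (a', b)) = of_bool (hit b)" if b: "b < k" for b
    proof -
      have eq: "(\<Sum>a'<k. of_bool (left a') * M $$ (a', b)) = (\<Sum>a'<k. of_bool (left a' \<and> r a' = ii b))"
        using b by (intro sum.cong) (auto simp: M_def ij cut_matrix_def left_def)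
      show ?thesis
      proof (cases "hit b")
        case True
        then obtain a where a: "a < k" "left a" "r a = ii b" by (auto simp: hit_def)
        have "(\<Sum>a'<k. of_bool (left a' \<and> r a' = ii b)) = (\<Sum>a'<k. if a' = a then 1 else 0 :: int)"
          using a req by (intro sum.cong) auto
        then show ?thesis using eq a True by simp
      next
        case False
        then have "(\<Sum>a'<k. of_bool (left a' \<and> r a' = ii b)) = (0 :: int)"
          by (intro sum.neutral) (auto simp: hit_def)
        then show ?thesis using eq False by simp
      qed
    qed
    have N: "(P * M) $$ (a, b) =
        (if r a = 0 then of_bool (ii b = 0) + of_bool (jj b = 0) - 1 + of_bool (hit b)
         else if left a then - of_bool (r a = ii b) else of_bool (r a - m + 1 = jj b))"
      if "a < k" "b < k" for a b
      unfolding mult[OF M that] hits[OF that(2)] using that by (auto simp: M_def ij cut_matrix_def left_def)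
    have hit0: "ii b \<noteq> 0" if "hit b" for b using that by (auto simp: hit_def left_def)
    show "det (P * M) \<in> {-1, 0, 1}"
    proof (rule det_network_matrix)
      show "P * M \<in> carrier_mat k k" using P M by simp
      show "(P * M) $$ (a, b) \<in> {-1, 0, 1}" if "a < k" "b < k" for a b
        unfolding N[OF that] using hit0[of b] by auto
      show "(P * M) $$ (a, b) + (P * M) $$ (a', b) = 0"
        if ab: "a < k" "a' < k" "b < k" "a \<noteq> a'" "(P * M) $$ (a, b) \<noteq> 0" "(P * M) $$ (a', b) \<noteq> 0" for a a' b
      proof -
        have neq: "r a \<noteq> r a'" using req ab by blast
        have L: "r c = ii b \<and> (P * M) $$ (c, b) = -1 \<and> hit b"
          if "c < k" "(P * M) $$ (c, b) \<noteq> 0" "left c" for c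
          using that N[OF that(1) ab(3)] unfolding hit_def by (auto simp: left_def split: if_splits)
        have R: "r c - m + 1 = jj b \<and> m \<le> r c \<and> (P * M) $$ (c, b) = 1"
          if "c < k" "(P * M) $$ (c, b) \<noteq> 0" "r c \<noteq> 0" "\<not> left c" for c
          using that N[OF that(1) ab(3)] by (simp add: left_def split: if_splits)
        have Z: "(P * M) $$ (c, b) = of_bool (ii b = 0) + of_bool (jj b = 0) - 1 + of_bool (hit b)"
          if "c < k" "r c = 0" for c
          using N[OF that(1) ab(3)] that by simp
        have RR: "\<not> (r c \<noteq> 0 \<and> \<not> left c)" if "c < k" "c' < k" "r c \<noteq> r c'" "r c' \<noteq> 0" "\<not> left c'"
            "(P * M) $$ (c, b) \<noteq> 0" "(P * M) $$ (c', b) \<noteq> 0" for c c'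
        proof
          assume "r c \<noteq> 0 \<and> \<not> left c"
          then have "r c - m + 1 = r c' - m + 1" "m \<le> r c" "m \<le> r c'"
            using R[of c] R[of c'] that by auto
          then show False using that(3) by linarith
        qed
        have opp: "(P * M) $$ (c, b) + (P * M) $$ (c', b) = 0"
          if c: "c < k" "c' < k" "r c = 0" "r c' \<noteq> 0" "(P * M) $$ (c, b) \<noteq> 0" "(P * M) $$ (c', b) \<noteq> 0" for c c'
        proof (cases "left c'")
          case True
          then show ?thesis using L[OF c(2,6)] Z[OF c(1,3)] c(5) hit0[of b] by (simp split: if_splits)
        next
          case False
          then show ?thesis using R[OF c(2,6,4)] Z[OF c(1,3)] c(5) hit0[of b]
            by (cases "hit b"; cases "ii b = 0") auto
        qed
        show ?thesis
        proof (cases "r a = 0 \<or> r a' = 0")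
          case True
          then show ?thesis using opp[of a a'] opp[of a' a] ab neq by (metis add.commute)
        next
          case False
          then show ?thesis
            using L[of a] L[of a'] R[of a] R[of a'] RR[of a a'] ab neq by (cases "left a"; cases "left a'") auto
        qed
      qed
    qed
  qed
  then show "det (mat k k (\<lambda>(i, j). cut_matrix m (r i) (q j))) \<in> {-1, 0, 1}" by (simp add: M_def)
qed

theorem realizes_cut_matrix:
  assumes "0 < m" "0 < n"
  shows "realizes (m + n - 1) (cut_matrix m) (cycle_matroid (complete_bipartite m n))"
  unfolding realizes_def ground_cycle_matroid_bip
  using assms by (simp add: totally_unimodular_cut_matrix standard_form_cut_matrix
    indep_cycle_matroid_bip cut_matrix_columns_independent_iff del: One_nat_def)

lemma regular_cycle_matroid_bip:
  assumes "0 < m" "0 < n"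
  shows "regular_matroid (cycle_matroid (complete_bipartite m n))"
  unfolding regular_matroid_def
proof
  show "is_matroid (cycle_matroid (complete_bipartite m n))"
  proof (rule is_matroid_if_columns)
    show "finite (ground (cycle_matroid (complete_bipartite m n)))"
      by (simp add: ground_cycle_matroid_bip)
    show "X \<in> indep (cycle_matroid (complete_bipartite m n)) \<longleftrightarrow>
      X \<subseteq> ground (cycle_matroid (complete_bipartite m n)) \<and>
      columns_independent (m + n - 1) (cut_matrix m) X" for X
      using cut_matrix_columns_independent_iff[OF _ assms]
      by (auto simp: indep_cycle_matroid_bip ground_cycle_matroid_bip)
  qed
qed (use realizes_cut_matrix[OF assms] in blast)

section \<open>Uniqueness of the realization\<close>

lemma star_independent_empty: "star_independent {}"
  by (simp add: star_independent_def)

lemma star_independent_insert_leaf: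
  assumes X: "star_independent X" "finite X" and v: "v \<in> s" "\<And>t. t \<in> X \<Longrightarrow> v \<notin> t"
  shows "star_independent (insert s X)"
  unfolding star_independent_def
proof (intro allI impI)
  fix x :: "'a set \<Rightarrow> rat"
  assume x: "\<forall>v. (\<Sum>s\<in>insert s X. x s * of_bool (v \<in> s)) = 0"
  have s: "s \<notin> X" using v by auto
  have split: "x s * of_bool (u \<in> s) + (\<Sum>s\<in>X. x s * of_bool (u \<in> s)) = 0" for u
    using x[rule_format, of u] X(2) s by (simp del: sum_mult_of_bool_eq)
  have "(\<Sum>s\<in>X. x s * of_bool (v \<in> s)) = 0" by (intro sum.neutral) (use v in auto)
  then have "x s = 0" using split[of v] v(1) by simp
  then show "\<forall>s\<in>insert s X. x s = 0"
    using split X(1) unfolding star_independent_def by auto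
qed

lemma columns_independent_4:
  fixes x1 x2 x3 x4 :: rat
  assumes "columns_independent g A {s1, s2, s3, s4}" "distinct [s1, s2, s3, s4]"
    and "\<And>k. k < g \<Longrightarrow> x1 * of_int (A k s1) + x2 * of_int (A k s2) + x3 * of_int (A k s3) + x4 * of_int (A k s4) = 0"
  shows "x1 = 0 \<and> x2 = 0 \<and> x3 = 0 \<and> x4 = 0"
proof -
  define x where "x = (\<lambda>_. 0 :: rat)(s1 := x1, s2 := x2, s3 := x3, s4 := x4)"
  have "(\<Sum>s\<in>{s1, s2, s3, s4}. x s * of_int (A k s)) = 0" if "k < g" for k
    using assms(2) assms(3)[OF that] by (simp add: x_def add.assoc)
  then have "\<forall>s\<in>{s1, s2, s3, s4}. x s = 0"
    using assms(1) unfolding columns_independent_def by blast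
  then show ?thesis using assms(2) by (simp add: x_def)
qed

lemma columns_dependent_4:
  assumes "\<not> columns_independent g A {s1, s2, s3, s4}" "distinct [s1, s2, s3, s4]"
  obtains x1 x2 x3 x4 :: rat where "x1 \<noteq> 0 \<or> x2 \<noteq> 0 \<or> x3 \<noteq> 0 \<or> x4 \<noteq> 0"
    "\<And>k. k < g \<Longrightarrow> x1 * of_int (A k s1) + x2 * of_int (A k s2) + x3 * of_int (A k s3) + x4 * of_int (A k s4) = 0"
proof -
  from assms(1) obtain x :: "'a \<Rightarrow> rat" and s where
    x: "\<And>k. k < g \<Longrightarrow> (\<Sum>s\<in>{s1, s2, s3, s4}. x s * of_int (A k s)) = 0"
    and s: "s \<in> {s1, s2, s3, s4}" "x s \<noteq> 0"
    unfolding columns_independent_def by auto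
  show thesis
    by (rule that[of "x s1" "x s2" "x s3" "x s4"]) (use x s assms(2) in \<open>auto simp: add.assoc\<close>)
qed

lemma columns_independent_standard_form:
  assumes inj: "inj_on \<beta> {..<g}"
    and id: "\<And>i j. i < g \<Longrightarrow> j < g \<Longrightarrow> A i (\<beta> j) = (if i = j then 1 else 0)"
  shows "columns_independent g A (\<beta> ` {..<g})"
  unfolding columns_independent_def
proof (intro allI impI ballI)
  fix x :: "'a \<Rightarrow> rat" and s
  assume x: "\<forall>i<g. (\<Sum>s\<in>\<beta> ` {..<g}. x s * of_int (A i s)) = 0" and "s \<in> \<beta> ` {..<g}"
  then obtain i where i: "i < g" "s = \<beta> i" by auto
  have "(\<Sum>s\<in>\<beta> ` {..<g}. x s * of_int (A i s)) = (\<Sum>j<g. if j = i then x (\<beta> j) else 0)"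
    unfolding sum.reindex[OF inj] o_def by (intro sum.cong refl) (use i id in auto)
  then show "x s = 0" using x i by simp
qed

section \<open>A spanning tree as integral basis in an arbitrary realization\<close>

locale bip_realization =
  fixes m n g :: nat and A :: "nat \<Rightarrow> (nat + nat) set \<Rightarrow> int"
  assumes mn: "2 \<le> m" "2 \<le> n"
    and realizes: "realizes g A (cycle_matroid (complete_bipartite m n))"
begin

abbreviation "S \<equiv> bip_edges m n"

definition tree :: "nat \<Rightarrow> (nat + nat) set" where
  "tree k = (if k < m then bip_edge k 0 else bip_edge 0 (k - m + 1))"

lemma columns_independent_iff:
  "X \<subseteq> S \<Longrightarrow> columns_independent g A X \<longleftrightarrow> star_independent X"
  using realizes unfolding realizes_def
  by (simp add: ground_cycle_matroid_bip indep_cycle_matroid_bip)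

lemma cut_independent_iff:
  "X \<subseteq> S \<Longrightarrow> columns_independent (m + n - 1) (cut_matrix m) X \<longleftrightarrow> star_independent X"
  using cut_matrix_columns_independent_iff[of X m n] mn by simp

lemma tree_mem: "k < m + n - 1 \<Longrightarrow> tree k \<in> S"
  using mn by (auto simp: tree_def)

lemma inj_tree: "inj_on tree {..<m + n - 1}"
  by (auto simp: inj_on_def tree_def split: if_splits)

lemma tree_independent: "columns_independent g A (tree ` {..<m + n - 1})"
proof -
  have "columns_independent (m + n - 1) (cut_matrix m) (tree ` {..<m + n - 1})"
    by (rule columns_independent_standard_form[OF inj_tree])
      (use mn in \<open>auto simp: tree_def cut_matrix_def\<close>)
  then show ?thesis
    using columns_independent_iff[of "tree ` {..<m + n - 1}"] cut_independent_iff[of "tree ` {..<m + n - 1}"]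
      tree_mem by auto
qed

text \<open>The identity columns of \<open>A\<close> are independent in \<open>cut_matrix\<close>,
  and the tree columns are independent in \<open>A\<close>. In each matrix the number of rows bounds
  an independent set.\<close>

lemma rank: "g = m + n - 1"
proof (rule antisym)
  have "standard_form g S A"
    using realizes unfolding realizes_def ground_cycle_matroid_bip by simp
  then obtain \<beta> where \<beta>: "\<beta> \<in> {..<g} \<rightarrow> S" "inj_on \<beta> {..<g}"
      and id: "\<And>i j. i < g \<Longrightarrow> j < g \<Longrightarrow> A i (\<beta> j) = (if i = j then 1 else 0)"
    unfolding standard_form_def by blast
  have "columns_independent g A (\<beta> ` {..<g})"
    by (rule columns_independent_standard_form[OF \<beta>(2) id])
  moreover have sub: "\<beta> ` {..<g} \<subseteq> S" using \<beta>(1) by auto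
  ultimately have "columns_independent (m + n - 1) (cut_matrix m) (\<beta> ` {..<g})"
    using columns_independent_iff[OF sub] cut_independent_iff[OF sub] by simp
  from card_le_rank_if_columns_independent[OF this] show "g \<le> m + n - 1"
    using card_image[OF \<beta>(2)] by simp
  from card_le_rank_if_columns_independent[OF tree_independent] show "m + n - 1 \<le> g"
    using card_image[OF inj_tree] by simp
qed

definition B :: "int mat" where "B = mat g g (\<lambda>(k, t). A k (tree t))"

lemma B: "B \<in> carrier_mat g g" by (simp add: B_def)

lemma minor: "q \<in> {..<g} \<rightarrow> S \<Longrightarrow> inj_on q {..<g} \<Longrightarrow> det (mat g g (\<lambda>(k, t). A k (q t))) \<in> {-1, 0, 1}"
proof -
  assume q: "q \<in> {..<g} \<rightarrow> S" "inj_on q {..<g}"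
  have "totally_unimodular g S A"
    using realizes unfolding realizes_def ground_cycle_matroid_bip by simp
  then have "det (mat g g (\<lambda>(i, j). A (id i) (q j))) \<in> {-1, 0, 1}"
    using q unfolding totally_unimodular_def by (auto dest!: spec[of _ g] spec[of _ id] spec[of _ q])
  then show ?thesis by simp
qed

text \<open>Independence of the tree columns excludes 0, and total unimodularity leaves only units.
  Hence \<open>B\<close> is invertible over the integers.\<close>

lemma det_B: "det B = 1 \<or> det B = -1"
proof -
  have "det B \<in> {-1, 0, 1}"
    unfolding B_def by (rule minor) (use tree_mem inj_tree rank in auto)
  moreover have "det B \<noteq> 0"
  proof
    assume "det B = 0"
    then obtain v where v: "v \<in> carrier_vec g" "v \<noteq> 0\<^sub>v g" "B *\<^sub>v v = 0\<^sub>v g"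
      using det_0_iff_vec_prod_zero[OF B] by auto
    define x :: "(nat + nat) set \<Rightarrow> rat" where "x s = of_int (v $ (the_inv_into {..<g} tree s))" for s
    have x: "x (tree t) = of_int (v $ t)" if "t < g" for t
      unfolding x_def using the_inv_into_f_f[of tree "{..<g}" t] inj_tree that rank by simp
    have "(\<Sum>s\<in>tree ` {..<g}. x s * of_int (A k s)) = 0" if k: "k < g" for k
    proof -
      have "(\<Sum>s\<in>tree ` {..<g}. x s * of_int (A k s)) = (\<Sum>t<g. of_int (v $ t) * of_int (A k (tree t)))"
        using inj_tree rank x by (simp add: sum.reindex)
      also have "\<dots> = of_int (\<Sum>t<g. A k (tree t) * v $ t)"
        by (simp add: mult.commute)
      also have "(\<Sum>t<g. A k (tree t) * v $ t) = (B *\<^sub>v v) $ k"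
        using k v(1) by (auto simp: B_def scalar_prod_def atLeast0LessThan intro!: sum.cong)
      finally show ?thesis using v(3) k by simp
    qed
    then have "\<forall>s\<in>tree ` {..<g}. x s = 0"
      using tree_independent unfolding columns_independent_def rank[symmetric] by blast
    then have "v $ t = 0" if "t < g" for t using x[OF that] that by simp
    then show False using v by (metis eq_vecI carrier_vecD index_zero_vec)
  qed
  ultimately show ?thesis by auto
qed

lemma B_inverse: "\<exists>C \<in> carrier_mat g g. B * C = 1\<^sub>m g \<and> C * B = 1\<^sub>m g"
proof (intro bexI conjI)
  show "det B \<cdot>\<^sub>m adj_mat B \<in> carrier_mat g g" using adj_mat(1)[OF B] by simp
  show "B * (det B \<cdot>\<^sub>m adj_mat B) = 1\<^sub>m g"
    unfolding mult_smult_distrib[OF B adj_mat(1)[OF B]] adj_mat(2)[OF B]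
    using det_B by (auto intro!: eq_matI)
  show "det B \<cdot>\<^sub>m adj_mat B * B = 1\<^sub>m g"
    unfolding mult_smult_assoc_mat[OF adj_mat(1)[OF B] B] adj_mat(3)[OF B]
    using det_B by (auto intro!: eq_matI)
qed

text \<open>Cramer's rule: a coordinate times \<open>det B\<close> is the maximal minor with one
  tree edge replaced by \<open>s\<close>.\<close>

lemma tree_coordinates:
  assumes s: "s \<in> S" "s \<notin> tree ` {..<g}"
  obtains c where "\<And>t. t < g \<Longrightarrow> c t \<in> {-1, 0, 1 :: int}"
    "\<And>k. k < g \<Longrightarrow> A k s = (\<Sum>t<g. c t * A k (tree t))"
proof -
  from B_inverse obtain C where C: "C \<in> carrier_mat g g" "B * C = 1\<^sub>m g" by blast
  define b where "b = vec g (\<lambda>k. A k s)"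
  define x where "x = C *\<^sub>v b"
  have b: "b \<in> carrier_vec g" by (simp add: b_def)
  have x: "x \<in> carrier_vec g" using C(1) b by (simp add: x_def)
  have Bx: "B *\<^sub>v x = b"
    unfolding x_def using assoc_mult_mat_vec[OF B C(1) b] C(2) b by simp
  show thesis
  proof (rule that[of "\<lambda>t. x $ t"])
    show "A k s = (\<Sum>t<g. x $ t * A k (tree t))" if k: "k < g" for k
    proof -
      have "A k s = (B *\<^sub>v x) $ k" using Bx k by (simp add: b_def)
      also have "\<dots> = (\<Sum>t<g. x $ t * A k (tree t))"
        using k x by (auto simp: B_def scalar_prod_def atLeast0LessThan mult.commute intro!: sum.cong)
      finally show ?thesis .
    qed
    show "x $ t \<in> {-1, 0, 1}" if t: "t < g" for t
    proof -
      define q where "q = tree(t := s)"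
      have "det (mat g g (\<lambda>(k, t). A k (q t))) \<in> {-1, 0, 1}"
      proof (rule minor)
        show "q \<in> {..<g} \<rightarrow> S" using s tree_mem rank by (auto simp: q_def)
        show "inj_on q {..<g}"
          unfolding q_def using inj_tree s rank by (auto intro: inj_on_fun_updI)
      qed
      moreover have "mat g g (\<lambda>(k, t). A k (q t)) = replace_col B (B *\<^sub>v x) t"
        unfolding Bx by (intro eq_matI) (auto simp: replace_col_def B_def b_def q_def)
      ultimately have "x $ t * det B \<in> {-1, 0, 1}"
        using cramer_lemma_mat[OF B x t] by simp
      then show ?thesis using det_B by auto
    qed
  qed
qed

end

section \<open>Column relations along four-cycles and the choice of signs\<close>

lemma square_forest:
  assumes "i \<noteq> i'" "j \<noteq> j'"
  shows "star_independent {bip_edge i j, bip_edge i j', bip_edge i' j}"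
proof -
  have "star_independent {bip_edge i j'}"
    by (rule star_independent_insert_leaf[OF star_independent_empty, of "Inl i"]) auto
  then have "star_independent {bip_edge i j, bip_edge i j'}"
    by (rule star_independent_insert_leaf[of _ "Inr j"]) (use assms in auto)
  then have "star_independent {bip_edge i' j, bip_edge i j, bip_edge i j'}"
    by (rule star_independent_insert_leaf[of _ "Inl i'"]) (use assms in auto)
  then show ?thesis by (simp add: insert_commute)
qed

lemma square_with_pendant_edge_forest:
  assumes "i \<noteq> i'" "j \<noteq> j'" "e \<in> {bip_edge i j'', bip_edge i'' j}"
    "j'' \<notin> {j, j'}" "i'' \<notin> {i, i'}"
  shows "star_independent {bip_edge i j, bip_edge i j', bip_edge i' j, e}"
proof -
  obtain v where v: "v \<in> e" "v \<in> {Inl i'', Inr j''}" using assms(3) by auto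
  have "star_independent (insert e {bip_edge i j, bip_edge i j', bip_edge i' j})"
    by (rule star_independent_insert_leaf[OF square_forest[OF assms(1,2)] _ v(1)])
      (use v assms in auto)
  then show ?thesis by (simp add: insert_commute)
qed

lemma sum_insert_4:
  "distinct [a, b, c, d] \<Longrightarrow> (\<Sum>s\<in>{a, b, c, d}. f s) = f a + f b + f c + (f d :: 'b::comm_monoid_add)"
  by (simp add: add.assoc)

lemma square_not_star_independent:
  assumes "i \<noteq> i'" "j \<noteq> j'"
  shows "\<not> star_independent {bip_edge i j, bip_edge i j', bip_edge i' j, bip_edge i' j'}"
proof
  assume ind: "star_independent {bip_edge i j, bip_edge i j', bip_edge i' j, bip_edge i' j'}"
  define x :: "(nat + nat) set \<Rightarrow> rat" where
    "x s = (if s = bip_edge i j \<or> s = bip_edge i' j' then 1 else -1)" for s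
  have x: "x (bip_edge i j) = 1" "x (bip_edge i j') = -1" "x (bip_edge i' j) = -1" "x (bip_edge i' j') = 1"
    using assms by (auto simp: x_def)
  have dist: "distinct [bip_edge i j, bip_edge i j', bip_edge i' j, bip_edge i' j']"
    using assms by simp
  have "(\<Sum>s\<in>{bip_edge i j, bip_edge i j', bip_edge i' j, bip_edge i' j'}. x s * of_bool (v \<in> s)) = 0" for v
    unfolding sum_insert_4[OF dist] x by auto
  then have "x (bip_edge i j) = 0" using ind unfolding star_independent_def by blast
  then show False by (simp add: x_def)
qed

context bip_realization
begin

text \<open>A four-cycle is a circuit: its columns are dependent, but any three of its edges form a
  path, so no coefficient of the dependency vanishes.\<close>

lemma square_relation:
  assumes "i < m" "i' < m" "j < n" "j' < n" "i \<noteq> i'" "j \<noteq> j'"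
  shows "\<exists>a b d :: rat. a \<noteq> 0 \<and> b \<noteq> 0 \<and> d \<noteq> 0 \<and>
    (\<forall>k<g. of_int (A k (bip_edge i' j')) =
       a * of_int (A k (bip_edge i j)) + b * of_int (A k (bip_edge i j')) + d * of_int (A k (bip_edge i' j)))"
proof -
  let ?s = "bip_edge i j" and ?s1 = "bip_edge i j'" and ?s2 = "bip_edge i' j" and ?s3 = "bip_edge i' j'"
  have dep: "\<not> columns_independent g A {?s, ?s1, ?s2, ?s3}"
    using columns_independent_iff[of "{?s, ?s1, ?s2, ?s3}"] square_not_star_independent[OF assms(5,6)] assms by simp
  have dist: "distinct [?s, ?s1, ?s2, ?s3]" using assms(5,6) by simp
  obtain x x1 x2 x3 :: rat
    where nz: "x \<noteq> 0 \<or> x1 \<noteq> 0 \<or> x2 \<noteq> 0 \<or> x3 \<noteq> 0"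
      and rel: "\<And>k. k < g \<Longrightarrow> x * of_int (A k ?s) + x1 * of_int (A k ?s1) + x2 * of_int (A k ?s2) + x3 * of_int (A k ?s3) = 0"
    by (rule columns_dependent_4[OF dep dist]) (rule that; assumption)
  \<comment> \<open>Stated for an arbitrary corner \<open>(a, b)\<close>, so that relabelling covers
    all four paths of three edges.\<close>
  have zero: "y1 = 0 \<and> y2 = 0 \<and> y3 = 0"
    if "a \<noteq> a'" "b \<noteq> b'" "a < m" "a' < m" "b < n" "b' < n"
      and rel: "\<And>k. k < g \<Longrightarrow> y1 * of_int (A k (bip_edge a b)) + y2 * of_int (A k (bip_edge a b')) + y3 * of_int (A k (bip_edge a' b)) = 0"
    for a a' b b' and y1 y2 y3 :: rat
  proof -
    have ind: "columns_independent g A {bip_edge a b, bip_edge a b', bip_edge a' b}"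
      using columns_independent_iff[of "{bip_edge a b, bip_edge a b', bip_edge a' b}"]
        square_forest[OF that(1,2)] that by simp
    define y where "y = (\<lambda>_. 0 :: rat)(bip_edge a b := y1, bip_edge a b' := y2, bip_edge a' b := y3)"
    have "(\<Sum>s\<in>{bip_edge a b, bip_edge a b', bip_edge a' b}. y s * of_int (A k s)) = 0" if "k < g" for k
      using rel[OF that] \<open>a \<noteq> a'\<close> \<open>b \<noteq> b'\<close> by (simp add: y_def add.assoc)
    then have "\<forall>s\<in>{bip_edge a b, bip_edge a b', bip_edge a' b}. y s = 0"
      using ind unfolding columns_independent_def by blast
    then show ?thesis using \<open>a \<noteq> a'\<close> \<open>b \<noteq> b'\<close> by (simp add: y_def)
  qed
  have "x3 \<noteq> 0"
  proof
    assume "x3 = 0"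
    then show False using zero[of i i' j j' x x1 x2] rel nz assms by simp
  qed
  moreover have "x \<noteq> 0"
  proof
    assume "x = 0"
    then show False using zero[of i' i j' j x3 x2 x1] rel nz assms by (simp add: add_ac)
  qed
  moreover have "x1 \<noteq> 0"
  proof
    assume "x1 = 0"
    then show False using zero[of i' i j j' x2 x3 x] rel nz assms by (simp add: add_ac)
  qed
  moreover have "x2 \<noteq> 0"
  proof
    assume "x2 = 0"
    then show False using zero[of i i' j' j x1 x x3] rel nz assms by (simp add: add_ac)
  qed
  moreover have "of_int (A k ?s3) = - x / x3 * of_int (A k ?s) + - x1 / x3 * of_int (A k ?s1) + - x2 / x3 * of_int (A k ?s2)"
    if "k < g" for k
    using rel[OF that] \<open>x3 \<noteq> 0\<close> by (simp add: divide_simps) (simp add: algebra_simps)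
  ultimately show ?thesis
    by (intro exI[of _ "- x / x3"] exI[of _ "- x1 / x3"] exI[of _ "- x2 / x3"]) simp
qed

text \<open>By independence of the tree, the nonzero rational coefficients of the four-cycle agree
  with the tree coordinates, so they are signs. Multiplying by \<open>c 0\<close> isolates the
  column of the edge \<open>(0, 0)\<close>.\<close>

lemma square_relation_signs:
  assumes ij: "0 < i" "i < m" "0 < j" "j < n"
  shows "\<exists>a b d :: int. a \<in> {-1, 1} \<and> b \<in> {-1, 1} \<and> d \<in> {-1, 1} \<and>
    (\<forall>k<g. A k (bip_edge 0 0) =
       a * A k (bip_edge i j) + b * A k (bip_edge 0 j) + d * A k (bip_edge i 0))"
proof -
  have "bip_edge i j \<noteq> tree t" for t using ij by (simp add: tree_def)
  then have s: "bip_edge i j \<in> S" "bip_edge i j \<notin> tree ` {..<g}" using ij by (simp, blast)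
  from tree_coordinates[OF s] obtain c where c: "\<And>t. t < g \<Longrightarrow> c t \<in> {-1, 0, 1 :: int}"
    and Ac: "\<And>k. k < g \<Longrightarrow> A k (bip_edge i j) = (\<Sum>t<g. c t * A k (tree t))" by blast
  have "0 < m" "0 < n" "0 \<noteq> i" "0 \<noteq> j" using ij by auto
  from square_relation[OF this(1) ij(2) this(2) ij(4) this(3,4)] obtain \<alpha> \<beta> \<gamma> :: rat where nz: "\<alpha> \<noteq> 0" "\<beta> \<noteq> 0" "\<gamma> \<noteq> 0"
    and rel: "\<And>k. k < g \<Longrightarrow> of_int (A k (bip_edge i j)) =
       \<alpha> * of_int (A k (bip_edge 0 0)) + \<beta> * of_int (A k (bip_edge 0 j)) + \<gamma> * of_int (A k (bip_edge i 0))"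
    by blast
  \<comment> \<open>The position of \<open>bip_edge 0 j\<close> in the enumeration
    \<open>tree\<close>.\<close>
  let ?t1 = "m + j - 1"
  have tree: "tree 0 = bip_edge 0 0" "tree i = bip_edge i 0" "tree ?t1 = bip_edge 0 j"
    and lt: "0 < g" "i < g" "?t1 < g" and dist: "0 \<noteq> i" "i \<noteq> ?t1" "0 \<noteq> ?t1"
    using ij mn rank by (auto simp: tree_def)
  define w :: "nat \<Rightarrow> rat" where "w t = (if t = 0 then \<alpha> else if t = i then \<gamma> else if t = ?t1 then \<beta> else 0)" for t
  have w: "w 0 = \<alpha>" "w i = \<gamma>" "w ?t1 = \<beta>" using dist by (auto simp: w_def)
  have wsum: "(\<Sum>t<g. w t * of_int (A k (tree t))) = of_int (A k (bip_edge i j))" if k: "k < g" for k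
  proof -
    have "(\<Sum>t<g. w t * of_int (A k (tree t))) = (\<Sum>t\<in>{0, i, ?t1}. w t * of_int (A k (tree t)))"
      using lt by (intro sum.mono_neutral_right) (auto simp: w_def)
    also have "\<dots> = w 0 * of_int (A k (tree 0)) + (w i * of_int (A k (tree i)) + w ?t1 * of_int (A k (tree ?t1)))"
      using dist by simp
    also have "\<dots> = of_int (A k (bip_edge i j))"
      using rel[OF k] unfolding w tree by simp
    finally show ?thesis .
  qed
  define x :: "(nat + nat) set \<Rightarrow> rat"
    where "x s = of_int (c (the_inv_into {..<g} tree s)) - w (the_inv_into {..<g} tree s)" for s
  have x: "x (tree t) = of_int (c t) - w t" if "t < g" for t
    unfolding x_def using the_inv_into_f_f[of tree "{..<g}" t] inj_tree that rank by simp
  have "(\<Sum>s\<in>tree ` {..<g}. x s * of_int (A k s)) = 0" if k: "k < g" for k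
  proof -
    have "(\<Sum>s\<in>tree ` {..<g}. x s * of_int (A k s)) = (\<Sum>t<g. (of_int (c t) - w t) * of_int (A k (tree t)))"
      using inj_tree rank x by (simp add: sum.reindex)
    also have "\<dots> = of_int (\<Sum>t<g. c t * A k (tree t)) - (\<Sum>t<g. w t * of_int (A k (tree t)))"
      by (simp add: left_diff_distrib sum_subtractf)
    finally show ?thesis using wsum[OF k] Ac[OF k] by simp
  qed
  then have "\<forall>s\<in>tree ` {..<g}. x s = 0"
    using tree_independent unfolding columns_independent_def rank[symmetric] by blast
  then have cw: "of_int (c t) = w t" if "t < g" for t using x[OF that] that by simp
  have sgn: "c t \<in> {-1, 1}" if "t < g" "w t \<noteq> 0" for t using cw[OF that(1)] c[OF that(1)] that(2) by auto
  have "A k (bip_edge i j) = c 0 * A k (bip_edge 0 0) + c ?t1 * A k (bip_edge 0 j) + c i * A k (bip_edge i 0)"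
    if k: "k < g" for k
  proof -
    have "(of_int (A k (bip_edge i j)) :: rat) =
      of_int (c 0 * A k (bip_edge 0 0) + c ?t1 * A k (bip_edge 0 j) + c i * A k (bip_edge i 0))"
      using rel[OF k] cw[OF lt(1)] cw[OF lt(2)] cw[OF lt(3)] w by simp
    then show ?thesis unfolding of_int_eq_iff .
  qed
  moreover have cs: "c 0 \<in> {-1, 1}" "c ?t1 \<in> {-1, 1}" "c i \<in> {-1, 1}"
    using sgn[OF lt(1)] sgn[OF lt(2)] sgn[OF lt(3)] w nz by simp_all
  ultimately have "\<forall>k<g. A k (bip_edge 0 0) =
      c 0 * A k (bip_edge i j) + (- c 0 * c ?t1) * A k (bip_edge 0 j) + (- c 0 * c i) * A k (bip_edge i 0)"
    by (auto simp: algebra_simps)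
  then show ?thesis
    using cs by (intro exI[of _ "c 0"] exI[of _ "- c 0 * c ?t1"] exI[of _ "- c 0 * c i"]) auto
qed

text \<open>If a coefficient depended on the square, adding two of the relations would express a
  nonzero multiple of the first column by the other three columns of a forest.\<close>

lemma sign_consistency:
  assumes "i < m" "i' < m" "j < n" "j' < n" "i \<noteq> i'" "j \<noteq> j'"
    and e: "e \<in> {bip_edge i j'', bip_edge i'' j}" "j'' \<notin> {j, j'}" "i'' \<notin> {i, i'}" "e \<in> S"
    and sg: "d \<in> {-1, 1}" "d' \<in> {-1, 1 :: int}"
    and rel: "\<And>k. k < g \<Longrightarrow> A k e = a * A k (bip_edge i' j') + b * A k (bip_edge i' j) + c * A k (bip_edge i j') + d * z k"
    and rel': "\<And>k. k < g \<Longrightarrow> A k e = a' * A k (bip_edge i j) + b' * A k (bip_edge i j') + c' * A k (bip_edge i' j) + d' * z k"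
  shows "d = d'"
proof (rule ccontr)
  assume "d \<noteq> d'"
  then have d': "d' = - d" using sg by auto
  obtain x y w :: rat where sq: "\<And>k. k < g \<Longrightarrow> of_int (A k (bip_edge i' j')) =
       x * of_int (A k (bip_edge i j)) + y * of_int (A k (bip_edge i j')) + w * of_int (A k (bip_edge i' j))"
    using square_relation[OF assms(1-6)] by blast
  have ind: "columns_independent g A {bip_edge i j, bip_edge i j', bip_edge i' j, e}"
    using columns_independent_iff[of "{bip_edge i j, bip_edge i j', bip_edge i' j, e}"]
      square_with_pendant_edge_forest[OF assms(5,6) e(1-3)] e(4) assms(1-4) by simp
  have dist: "distinct [bip_edge i j, bip_edge i j', bip_edge i' j, e]"
  proof -
    have "e = bip_edge i j'' \<or> e = bip_edge i'' j" using e(1) by simp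
    then show ?thesis using assms(5,6) e(2,3) by (elim disjE) simp_all
  qed
  \<comment> \<open>Opposite signs cancel \<open>z\<close> in the sum of the two relations, and
    \<open>sq\<close> removes the fourth corner. The coefficient \<open>- 2\<close> of
    \<open>e\<close> contradicts independence.\<close>
  have rels: "(of_int a * x + of_int a') * of_int (A k (bip_edge i j)) + (of_int a * y + of_int c + of_int b') * of_int (A k (bip_edge i j'))
      + (of_int a * w + of_int b + of_int c') * of_int (A k (bip_edge i' j)) + (- 2) * of_int (A k e) = 0" if k: "k < g" for k
  proof -
    have "2 * A k e = a * A k (bip_edge i' j') + b * A k (bip_edge i' j) + c * A k (bip_edge i j') + a' * A k (bip_edge i j)
      + b' * A k (bip_edge i j') + c' * A k (bip_edge i' j)"
      using rel[OF k] rel'[OF k] d' by simp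
    then have "(of_int (2 * A k e) :: rat) = of_int (a * A k (bip_edge i' j') + b * A k (bip_edge i' j) + c * A k (bip_edge i j') + a' * A k (bip_edge i j)
      + b' * A k (bip_edge i j') + c' * A k (bip_edge i' j))"
      by (rule arg_cong)
    then show ?thesis unfolding of_int_add of_int_mult sq[OF k] by (simp add: algebra_simps)
  qed
  from columns_independent_4[OF ind dist rels] show False by simp
qed

text \<open>Once \<beta> depends only on the column and \<gamma> only on the row, they serve as
  signs for the edges \<open>(0, j)\<close> and \<open>(i, 0)\<close>, and minus \<alpha> for
  \<open>(i, j)\<close>. Every square relation becomes \<open>x_ij = x_i0 + x_0j - x_00\<close>,
  which \<open>P\<close> and \<open>Q\<close> solve.\<close>

lemma columns_signed_potentials:
  "\<exists>(\<epsilon> :: nat \<Rightarrow> nat \<Rightarrow> int) P Q. (\<forall>i<m. \<forall>j<n. \<epsilon> i j \<in> {-1, 1}) \<and>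
     (\<forall>k<g. \<forall>i<m. \<forall>j<n. \<epsilon> i j * A k (bip_edge i j) = P k i + Q k j)"
proof -
  let ?A = "\<lambda>i j k. A k (bip_edge i j)"
  define good where "good i j a b d \<longleftrightarrow> a \<in> {-1, 1 :: int} \<and> b \<in> {-1, 1 :: int} \<and> d \<in> {-1, 1 :: int} \<and>
    (\<forall>k<g. ?A 0 0 k = a * ?A i j k + b * ?A 0 j k + d * ?A i 0 k)" for i j a b d
  have "\<exists>a b d. 0 < i \<and> i < m \<and> 0 < j \<and> j < n \<longrightarrow> good i j a b d" for i j
    using square_relation_signs[of i j] unfolding good_def by blast
  then obtain \<alpha> \<beta> \<gamma> where abc: "\<And>i j. 0 < i \<Longrightarrow> i < m \<Longrightarrow> 0 < j \<Longrightarrow> j < n \<Longrightarrow> good i j (\<alpha> i j) (\<beta> i j) (\<gamma> i j)"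
    by metis
  have rel: "?A 0 0 k = \<alpha> i j * ?A i j k + \<beta> i j * ?A 0 j k + \<gamma> i j * ?A i 0 k"
    and sg: "\<alpha> i j \<in> {-1, 1}" "\<beta> i j \<in> {-1, 1}" "\<gamma> i j \<in> {-1, 1}"
    if "0 < i" "i < m" "0 < j" "j < n" "k < g" for i j k
    using abc[OF that(1-4)] that(5) unfolding good_def by blast+
  have g: "0 < g" using rank mn by simp
  have S0: "bip_edge 0 0 \<in> S" using mn by simp
  have \<beta>: "\<beta> i j = \<beta> 1 j" if ij: "0 < i" "i < m" "0 < j" "j < n" for i j
  proof (cases "i = 1")
    case False
    have one: "0 < (1 :: nat)" "1 < m" using mn by auto
    \<comment> \<open>The relations for the rows \<open>i\<close> and 1 share the column of
      \<open>(0, j)\<close>, taken as \<open>z\<close>. The edge \<open>(0, 0)\<close> is pendant to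
      the square on rows 1, \<open>i\<close> and columns 0, \<open>j\<close>; \<open>Suc j\<close>
      is merely an index different from 0 and \<open>j\<close>.\<close>
    show ?thesis
    proof (rule sign_consistency[where i = 1 and i' = i and j = 0 and j' = j and j'' = "Suc j" and i'' = 0
          and a = "\<alpha> i j" and b = "\<gamma> i j" and c = 0 and a' = "\<gamma> 1 j" and b' = "\<alpha> 1 j" and c' = 0
          and e = "bip_edge 0 0" and z = "?A 0 j"])
      fix k assume k: "k < g"
      show "?A 0 0 k = \<alpha> i j * ?A i j k + \<gamma> i j * ?A i 0 k + 0 * ?A 1 j k + \<beta> i j * ?A 0 j k"
        using rel[OF ij k] by simp
      show "?A 0 0 k = \<gamma> 1 j * ?A 1 0 k + \<alpha> 1 j * ?A 1 j k + 0 * ?A i 0 k + \<beta> 1 j * ?A 0 j k"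
        using rel[OF one ij(3,4) k] by simp
    qed (use ij one False S0 sg[OF ij g] sg[OF one ij(3,4) g] in simp_all)
  qed simp
  have \<gamma>: "\<gamma> i j = \<gamma> i 1" if ij: "0 < i" "i < m" "0 < j" "j < n" for i j
  proof (cases "j = 1")
    case False
    have one: "0 < (1 :: nat)" "1 < n" using mn by auto
    show ?thesis
    proof (rule sign_consistency[where i = 0 and i' = i and j = 1 and j' = j and j'' = 0 and i'' = "Suc i"
          and a = "\<alpha> i j" and b = 0 and c = "\<beta> i j" and a' = "\<beta> i 1" and b' = 0 and c' = "\<alpha> i 1"
          and e = "bip_edge 0 0" and z = "?A i 0"])
      fix k assume k: "k < g"
      show "?A 0 0 k = \<alpha> i j * ?A i j k + 0 * ?A i 1 k + \<beta> i j * ?A 0 j k + \<gamma> i j * ?A i 0 k"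
        using rel[OF ij k] by simp
      show "?A 0 0 k = \<beta> i 1 * ?A 0 1 k + 0 * ?A 0 j k + \<alpha> i 1 * ?A i 1 k + \<gamma> i 1 * ?A i 0 k"
        using rel[OF ij(1,2) one k] by simp
    qed (use ij one False S0 sg[OF ij g] sg[OF ij(1,2) one g] in simp_all)
  qed simp
  define \<epsilon> where "\<epsilon> i j = (if i = 0 then if j = 0 then 1 else \<beta> 1 j
    else if j = 0 then \<gamma> i 1 else - \<alpha> i j)" for i j
  define P where "P k i = \<epsilon> i 0 * ?A i 0 k - ?A 0 0 k" for k i
  define Q where "Q k j = \<epsilon> 0 j * ?A 0 j k" for k j
  have one: "0 < (1 :: nat)" "1 < m" "1 < n" using mn by auto
  have "\<epsilon> i j \<in> {-1, 1}" if "i < m" "j < n" for i j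
    using sg(1)[of i j, OF _ _ _ _ g] sg(2)[of 1 j, OF _ _ _ _ g] sg(3)[of i 1, OF _ _ _ _ g] that one
    unfolding \<epsilon>_def by auto
  moreover have "\<epsilon> i j * ?A i j k = P k i + Q k j" if "k < g" "i < m" "j < n" for i j k
  proof (cases "i = 0 \<or> j = 0")
    case True
    then show ?thesis by (auto simp: P_def Q_def \<epsilon>_def)
  next
    case False
    then show ?thesis
      using rel[of i j k] \<beta>[of i j] \<gamma>[of i j] that by (simp add: P_def Q_def \<epsilon>_def)
  qed
  ultimately show ?thesis by blast
qed

text \<open>Up to the signs \<epsilon>, the lattice consists of the cuts. All cuts occur because the
  integral inverse of \<open>B\<close> allows the entries on the tree to be prescribed.\<close>

theorem row_lattice_signed_potentials:
  obtains \<epsilon> :: "nat \<Rightarrow> nat \<Rightarrow> int"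
  where "\<And>i j. i < m \<Longrightarrow> j < n \<Longrightarrow> \<epsilon> i j \<in> {-1, 1}"
    and "\<And>u. u \<in> row_lattice g S A \<Longrightarrow>
           \<exists>p q. \<forall>i<m. \<forall>j<n. u (bip_edge i j) = \<epsilon> i j * (p i + q j)"
    and "\<And>p q. \<exists>u \<in> row_lattice g S A. \<forall>i<m. \<forall>j<n. u (bip_edge i j) = \<epsilon> i j * (p i + q j)"
proof -
  obtain \<epsilon> :: "nat \<Rightarrow> nat \<Rightarrow> int" and P Q where \<epsilon>: "\<And>i j. i < m \<Longrightarrow> j < n \<Longrightarrow> \<epsilon> i j \<in> {-1, 1}"
    and PQ: "\<And>k i j. k < g \<Longrightarrow> i < m \<Longrightarrow> j < n \<Longrightarrow> \<epsilon> i j * A k (bip_edge i j) = P k i + Q k j"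
    using columns_signed_potentials by blast
  have sq: "\<epsilon> i j * (\<epsilon> i j * x) = x" if "i < m" "j < n" for i j x
    using \<epsilon>[OF that] by auto
  have pot: "(\<Sum>k<g. z k * A k (bip_edge i j)) = \<epsilon> i j * ((\<Sum>k<g. z k * P k i) + (\<Sum>k<g. z k * Q k j))"
    if "i < m" "j < n" for z i j
  proof -
    have "\<epsilon> i j * (\<Sum>k<g. z k * A k (bip_edge i j)) = (\<Sum>k<g. z k * (\<epsilon> i j * A k (bip_edge i j)))"
      by (simp add: sum_distrib_left mult.left_commute)
    also have "\<dots> = (\<Sum>k<g. z k * P k i) + (\<Sum>k<g. z k * Q k j)"
      using PQ that by (simp add: distrib_left sum.distrib)
    finally show ?thesis using sq[OF that] by metis
  qed
  show thesis
  proof (rule that[of \<epsilon>])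
    show "\<epsilon> i j \<in> {-1, 1}" if "i < m" "j < n" for i j by (rule \<epsilon>[OF that])
    show "\<exists>p q. \<forall>i<m. \<forall>j<n. u (bip_edge i j) = \<epsilon> i j * (p i + q j)"
      if u: "u \<in> row_lattice g S A" for u
    proof -
      from u obtain z where z: "u = (\<lambda>s\<in>S. \<Sum>k<g. z k * A k s)" unfolding row_lattice_def by blast
      show ?thesis
        by (rule exI[of _ "\<lambda>i. \<Sum>k<g. z k * P k i"], rule exI[of _ "\<lambda>j. \<Sum>k<g. z k * Q k j"])
          (simp add: z pot)
    qed
    show "\<exists>u \<in> row_lattice g S A. \<forall>i<m. \<forall>j<n. u (bip_edge i j) = \<epsilon> i j * (p i + q j)" for p q
    proof -
      \<comment> \<open>The signed values of the desired cut on the tree. They fix the rest through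
        \<open>p i + q j = (p i + q 0) + (p 0 + q j) - (p 0 + q 0)\<close>.\<close>
      define w where "w t = (if t < m then \<epsilon> t 0 * (p t + q 0) else \<epsilon> 0 (t - m + 1) * (p 0 + q (t - m + 1)))" for t
      from B_inverse obtain C where C: "C \<in> carrier_mat g g" "C * B = 1\<^sub>m g" by blast
      define z where "z k = (\<Sum>t<g. w t * C $$ (t, k))" for k
      have z: "(\<Sum>k<g. z k * A k (tree t)) = w t" if t: "t < g" for t
      proof -
        have CB: "(\<Sum>k<g. C $$ (t', k) * A k (tree t)) = (if t' = t then 1 else 0)" if "t' < g" for t'
        proof -
          have "(C * B) $$ (t', t) = (\<Sum>k<g. C $$ (t', k) * A k (tree t))"
            using that t C(1) B by (auto simp: B_def scalar_prod_def atLeast0LessThan intro!: sum.cong)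
          then show ?thesis using C(2) that t by simp
        qed
        have "(\<Sum>k<g. z k * A k (tree t)) = (\<Sum>t'<g. w t' * (\<Sum>k<g. C $$ (t', k) * A k (tree t)))"
          unfolding z_def sum_distrib_right sum_distrib_left by (subst sum.swap) (simp add: mult.assoc)
        also have "\<dots> = (\<Sum>t'<g. if t' = t then w t else 0)"
          by (intro sum.cong refl) (auto simp: CB)
        finally show ?thesis using t by simp
      qed
      define p' where "p' i = (\<Sum>k<g. z k * P k i)" for i
      define q' where "q' j = (\<Sum>k<g. z k * Q k j)" for j
      have eq: "(\<Sum>k<g. z k * A k (bip_edge i j)) = \<epsilon> i j * (p' i + q' j)" if "i < m" "j < n" for i j
        using pot[OF that] by (simp add: p'_def q'_def)
      have cancel: "a = b" if "\<epsilon> i j * a = \<epsilon> i j * b" "i < m" "j < n" for i j a b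
        using sq[OF that(2,3)] that(1) by metis
      have 1: "p' i + q' 0 = p i + q 0" if "i < m" for i
      proof (rule cancel[of i 0])
        have "i < g" "tree i = bip_edge i 0" using that mn rank by (auto simp: tree_def)
        then show "\<epsilon> i 0 * (p' i + q' 0) = \<epsilon> i 0 * (p i + q 0)"
          using z[of i] eq[of i 0] that mn by (simp add: w_def)
      qed (use that mn in auto)
      have 2: "p' 0 + q' j = p 0 + q j" if "j < n" for j
      proof (cases "j = 0")
        case False
        show ?thesis
        proof (rule cancel[of 0 j])
          have "m + j - 1 < g" "tree (m + j - 1) = bip_edge 0 j" "w (m + j - 1) = \<epsilon> 0 j * (p 0 + q j)"
            using that mn rank False by (auto simp: tree_def w_def)
          then show "\<epsilon> 0 j * (p' 0 + q' j) = \<epsilon> 0 j * (p 0 + q j)"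
            using z[of "m + j - 1"] eq[of 0 j] that mn by simp
        qed (use that mn in auto)
      qed (use 1[of 0] mn in simp)
      have "p' i + q' j = p i + q j" if "i < m" "j < n" for i j
        using 1[OF that(1)] 2[OF that(2)] 1[of 0] mn by simp
      then show ?thesis
        by (intro bexI[of _ "\<lambda>s\<in>S. \<Sum>k<g. z k * A k s"]) (auto simp: eq row_lattice_def)
    qed
  qed
qed

end

section \<open>Obstructions to solutions\<close>

lemma reduce_cong: "s \<in> S \<Longrightarrow> [reduce l S v s = v s] (mod int l)"
  by (simp add: reduce_def cong_def)

lemma coset_reduce: "coset l S W (reduce l S v) = coset l S W v"
proof -
  have "reduce l S (\<lambda>s. reduce l S v s + w s) = reduce l S (\<lambda>s. v s + w s)" for w
    by (auto simp: reduce_def mod_simps)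
  then show ?thesis unfolding coset_def by simp
qed

lemma reduce_mem: "0 < l \<Longrightarrow> reduce l S v \<in> S \<rightarrow>\<^sub>E Fl l"
  by (auto simp: reduce_def Fl_def)

lemma coset_mem_Alb_verts: "0 < l \<Longrightarrow> coset l S W v \<in> Alb_verts l S W"
  unfolding Alb_verts_def using reduce_mem[of l S v] coset_reduce[of l S W v] by (metis imageI)

lemma finite_Alb_verts: "finite S \<Longrightarrow> finite (Alb_verts l S W)"
  unfolding Alb_verts_def by (intro finite_imageI finite_PiE) (auto simp: Fl_def)

lemma Alb_edges_image:
  "Alb_edges l S W =
     (\<lambda>(v, s). (coset l S W v, s, coset l S W (v(s := v s + 1)))) ` ((S \<rightarrow>\<^sub>E Fl l) \<times> S)"
  by (auto simp: Alb_edges_def image_iff)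

lemma finite_Alb_edges: "finite S \<Longrightarrow> finite (Alb_edges l S W)"
  unfolding Alb_edges_image by (intro finite_imageI finite_cartesian_product finite_PiE) (auto simp: Fl_def)

lemma Alb_edgesE:
  assumes "e \<in> Alb_edges l S W"
  obtains v where "tail e = coset l S W v" "head e = coset l S W (v(color e := v (color e) + 1))"
    "color e \<in> S"
  using assms by (auto simp: Alb_edges_def)

lemma lin_comb_cong:
  assumes fin: "finite S" and e: "e \<in> E" and s: "color e \<in> S"
    and supp: "\<And>s. s \<in> S \<Longrightarrow> color e \<noteq> s \<Longrightarrow> b s e = 0"
  shows "[lin_comb l S E c b e = c (color e) * b (color e) e] (mod int l)"
proof -
  have "(\<Sum>s\<in>S - {color e}. c s * b s e) = 0"
    by (intro sum.neutral) (metis DiffE insertI1 mult_zero_right supp)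
  then have "(\<Sum>s\<in>S. c s * b s e) = c (color e) * b (color e) e"
    using sum.remove[OF fin s, of "\<lambda>s. c s * b s e"] by simp
  then show ?thesis using e by (simp add: lin_comb_def cong_def)
qed

text \<open>Pairing the boundary equations at the vertices \<open>x\<close> for the combinations \<open>F x\<close> and
  summing by parts moves the difference operator from the solution to \<open>F\<close>.\<close>

lemma solution_certificate:
  fixes \<gamma> :: "'a \<Rightarrow> int"
  assumes l: "0 < l" and fin: "finite S" and sol: "is_solution l g S A b"
    and W: "W = row_lattice_mod l g S A"
    and F: "\<And>x. x \<in> Alb_verts l S W \<Longrightarrow> F x \<in> W"
    and \<gamma>: "\<And>e. e \<in> Alb_edges l S W \<Longrightarrow> [F (head e) (color e) - F (tail e) (color e) = \<gamma> (color e)] (mod int l)"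
  shows "[(\<Sum>s\<in>S. \<gamma> s * color_profile l S (Alb_edges l S W) (b s) s) = 0] (mod int l)"
proof -
  define V where "V = Alb_verts l S W"
  define E where "E = Alb_edges l S W"
  have finV: "finite V" and finE: "finite E"
    unfolding V_def E_def by (simp_all add: finite_Alb_verts finite_Alb_edges fin)
  have supp: "b s e = 0" if "s \<in> S" "e \<in> E" "color e \<noteq> s" for s e
    using sol that unfolding is_solution_def Let_def E_def W by blast
  have closed: "closed_chain l V E (lin_comb l S E c b)" if "c \<in> W" for c
    using sol that unfolding is_solution_def Let_def E_def V_def W by blast
  have ends: "head e \<in> V" "tail e \<in> V" "color e \<in> S" if "e \<in> E" for e
    using that coset_mem_Alb_verts[OF l, of S W] unfolding E_def V_def by (auto elim: Alb_edgesE)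
  \<comment> \<open>The chains \<open>b s\<close> have disjoint supports, so a single chain carries
    them all; in the combination for \<open>F x\<close> the edge \<open>e\<close> gets the weight
    \<open>F x (color e)\<close>.\<close>
  define B where "B e = b (color e) e" for e
  have bd: "[(\<Sum>e\<in>E. B e * (F x (color e) * (of_bool (head e = x) - of_bool (tail e = x)))) = 0] (mod int l)"
    if x: "x \<in> V" for x
  proof -
    have 1: "[boundary E (lin_comb l S E (F x) b) x = 0] (mod int l)"
      using closed[OF F] x unfolding closed_chain_def V_def cong_def by simp
    have 2: "[boundary E (lin_comb l S E (F x) b) x =
      (\<Sum>e\<in>E. (F x (color e) * b (color e) e) * (of_bool (head e = x) - of_bool (tail e = x)))] (mod int l)"
      unfolding boundary_def
      by (intro cong_sum cong_mult cong_refl lin_comb_cong[OF fin]) (use ends supp in auto)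
    have 3: "(\<Sum>e\<in>E. (F x (color e) * b (color e) e) * (of_bool (head e = x) - of_bool (tail e = x))) =
        (\<Sum>e\<in>E. B e * (F x (color e) * (of_bool (head e = x) - of_bool (tail e = x))))"
      by (intro sum.cong refl) (simp add: B_def ac_simps)
    from cong_trans[OF cong_sym[OF 2] 1] show ?thesis unfolding 3 .
  qed
  have "[(\<Sum>x\<in>V. \<Sum>e\<in>E. B e * (F x (color e) * (of_bool (head e = x) - of_bool (tail e = x)))) = (\<Sum>x\<in>V. 0)] (mod int l)"
    by (intro cong_sum bd)
  also have "(\<Sum>x\<in>V. \<Sum>e\<in>E. B e * (F x (color e) * (of_bool (head e = x) - of_bool (tail e = x)))) =
    (\<Sum>e\<in>E. B e * (F (head e) (color e) - F (tail e) (color e)))"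
  proof (subst sum.swap, intro sum.cong refl)
    fix e assume "e \<in> E"
    then have "(\<Sum>x\<in>V. F x (color e) * of_bool (head e = x)) = F (head e) (color e)"
      "(\<Sum>x\<in>V. F x (color e) * of_bool (tail e = x)) = F (tail e) (color e)"
      using finV ends[of e] by (simp_all add: of_bool_def if_distrib[of "\<lambda>u. _ * u"] cong: if_cong)
    then show "(\<Sum>x\<in>V. B e * (F x (color e) * (of_bool (head e = x) - of_bool (tail e = x)))) =
      B e * (F (head e) (color e) - F (tail e) (color e))"
      by (simp add: sum_distrib_left[symmetric] right_diff_distrib sum_subtractf del: sum_mult_of_bool_eq)
  qed
  finally have 1: "[(\<Sum>e\<in>E. B e * (F (head e) (color e) - F (tail e) (color e))) = 0] (mod int l)" by simp
  have 2: "[(\<Sum>e\<in>E. B e * (F (head e) (color e) - F (tail e) (color e))) = (\<Sum>e\<in>E. B e * \<gamma> (color e))] (mod int l)"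
    by (intro cong_sum cong_mult cong_refl \<gamma>) (simp add: E_def)
  have 3: "(\<Sum>e\<in>E. B e * \<gamma> (color e)) = (\<Sum>s\<in>S. \<gamma> s * (\<Sum>e\<in>{e\<in>E. color e = s}. b s e))"
  proof -
    have "(\<Sum>e\<in>E. B e * \<gamma> (color e)) = (\<Sum>s\<in>S. \<Sum>e\<in>{e\<in>E. color e = s}. B e * \<gamma> (color e))"
      by (rule sum.group[OF finE fin, symmetric]) (use ends in auto)
    also have "\<dots> = (\<Sum>s\<in>S. \<gamma> s * (\<Sum>e\<in>{e\<in>E. color e = s}. b s e))"
      by (intro sum.cong refl) (auto simp: B_def sum_distrib_left mult.commute intro!: sum.cong)
    finally show ?thesis .
  qed
  have 4: "[(\<Sum>s\<in>S. \<gamma> s * color_profile l S E (b s) s) =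
      (\<Sum>s\<in>S. \<gamma> s * (\<Sum>e\<in>{e\<in>E. color e = s}. b s e))] (mod int l)"
    unfolding color_profile_def by (intro cong_sum cong_mult cong_refl reduce_cong)
  from cong_trans[OF 4 cong_trans[OF cong_sym[OF 2[unfolded 3]] 1]] show ?thesis unfolding E_def .
qed

text \<open>The class of a matrix \<open>v\<close> modulo the cuts has the coordinates
  \<open>y\<^sub>a\<^sub>b = v\<^sub>a\<^sub>b - v\<^sub>0\<^sub>b - v\<^sub>a\<^sub>0 + v\<^sub>0\<^sub>0\<close>; below are those of \<open>e\<^sub>i\<^sub>j\<close>. They vanish for \<open>a = 0\<close> or \<open>b = 0\<close>.\<close>

definition unit_coords :: "nat \<Rightarrow> nat \<Rightarrow> nat \<Rightarrow> nat \<Rightarrow> int" where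
  "unit_coords i j a b = (of_bool (a = i) - of_bool (i = 0)) * (of_bool (b = j) - of_bool (j = 0))"

text \<open>Builds the map \<open>F\<close> of \<open>solution_certificate\<close> from potentials
  in the coordinates \<open>y\<close>. The two congruence hypotheses make the potentials well
  defined on classes modulo \<open>l\<close>; the column signs of the realization are absorbed by
  \<open>Y\<close> and \<open>L\<close>.\<close>

lemma (in bip_realization) solution_potential_certificate:
  fixes p q :: "nat \<Rightarrow> (nat \<Rightarrow> nat \<Rightarrow> int) \<Rightarrow> int" and \<gamma> :: "nat \<Rightarrow> nat \<Rightarrow> int"
  assumes l: "0 < l"
    and p: "\<And>i y y'. (\<And>a b. a < m \<Longrightarrow> b < n \<Longrightarrow> [y a b = y' a b] (mod int l)) \<Longrightarrow> [p i y = p i y'] (mod int l)"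
    and q: "\<And>j y y'. (\<And>a b. a < m \<Longrightarrow> b < n \<Longrightarrow> [y a b = y' a b] (mod int l)) \<Longrightarrow> [q j y = q j y'] (mod int l)"
    and step: "\<And>i j y. i < m \<Longrightarrow> j < n \<Longrightarrow>
      [p i (\<lambda>a b. y a b + unit_coords i j a b) + q j (\<lambda>a b. y a b + unit_coords i j a b) = p i y + q j y + \<gamma> i j] (mod int l)"
    and sol: "is_solution l g S A b"
    and prof: "\<And>s. s \<in> S \<Longrightarrow> color_profile l S (Alb_edges l S (row_lattice_mod l g S A)) (b s) s = c"
  shows "[c * (\<Sum>i<m. \<Sum>j<n. \<gamma> i j) = 0] (mod int l)"
proof -
  obtain \<epsilon> :: "nat \<Rightarrow> nat \<Rightarrow> int" where \<epsilon>: "\<And>i j. i < m \<Longrightarrow> j < n \<Longrightarrow> \<epsilon> i j \<in> {-1, 1}"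
    and pot: "\<And>u. u \<in> row_lattice g S A \<Longrightarrow> \<exists>p q. \<forall>i<m. \<forall>j<n. u (bip_edge i j) = \<epsilon> i j * (p i + q j)"
    and lat: "\<And>p q. \<exists>u \<in> row_lattice g S A. \<forall>i<m. \<forall>j<n. u (bip_edge i j) = \<epsilon> i j * (p i + q j)"
    using row_lattice_signed_potentials by blast
  have m0: "0 < m" "0 < n" using mn by auto
  have \<epsilon>\<epsilon>: "\<epsilon> i j * \<epsilon> i j = 1" if "i < m" "j < n" for i j using \<epsilon>[OF that] by auto
  define W where "W = row_lattice_mod l g S A"
  \<comment> \<open>After the signs are undone, \<open>Y\<close> annihilates all matrices
    \<open>p i + q j\<close>, hence is constant modulo \<open>l\<close> on cosets.\<close>
  define Y where "Y u a b = \<epsilon> a b * u (bip_edge a b) - \<epsilon> 0 b * u (bip_edge 0 b)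
    - \<epsilon> a 0 * u (bip_edge a 0) + \<epsilon> 0 0 * u (bip_edge 0 0)" for u a b
  have Y_cong: "[Y u a b = Y u' a b] (mod int l)"
    if "\<And>s. s \<in> S \<Longrightarrow> [u s = u' s] (mod int l)" "a < m" "b < n" for u u' a b
    unfolding Y_def by (intro cong_add cong_diff cong_mult cong_refl that(1)) (use that m0 in auto)
  have Y_lattice: "Y (\<lambda>s. v s + r s) a b = Y v a b" if r: "r \<in> row_lattice g S A" and ab: "a < m" "b < n" for v r a b
  proof -
    obtain p' q' where "\<forall>i<m. \<forall>j<n. r (bip_edge i j) = \<epsilon> i j * (p' i + q' j)" using pot[OF r] by blast
    then have "\<epsilon> i j * r (bip_edge i j) = p' i + q' j" if "i < m" "j < n" for i j
      using that \<epsilon>\<epsilon>[OF that] by (metis mult.assoc mult_1)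
    then show ?thesis using ab m0 by (simp add: Y_def algebra_simps)
  qed
  have Y_coset: "[Y u a b = Y v a b] (mod int l)" if u: "u \<in> coset l S W v" and ab: "a < m" "b < n" for u v a b
  proof -
    obtain r where r: "r \<in> row_lattice g S A" and u: "u = reduce l S (\<lambda>s. v s + reduce l S r s)"
      using u unfolding coset_def W_def row_lattice_mod_def by auto
    have "[u s = v s + r s] (mod int l)" if "s \<in> S" for s
      using that by (simp add: u reduce_def cong_def mod_simps)
    then have "[Y u a b = Y (\<lambda>s. v s + r s) a b] (mod int l)" using ab by (rule Y_cong)
    then show ?thesis using Y_lattice[OF r ab] by simp
  qed
  have Y_step: "Y (v(bip_edge i j := v (bip_edge i j) + 1)) a b = Y v a b + \<epsilon> i j * unit_coords i j a b" for v i j a b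
    by (auto simp: Y_def unit_coords_def algebra_simps)
  \<comment> \<open>Any representative serves: by \<open>Y_coset\<close> its coordinates are
    determined modulo \<open>l\<close>.\<close>
  define pt where "pt x = (SOME u. u \<in> x)" for x :: "((nat + nat) set \<Rightarrow> int) set"
  have zero_lat: "(\<lambda>s\<in>S. 0) \<in> row_lattice g S A"
    unfolding row_lattice_def by (intro CollectI exI[of _ "\<lambda>_. 0"]) simp
  have "W \<noteq> {}" using zero_lat by (auto simp: W_def row_lattice_mod_def)
  then have "coset l S W v \<noteq> {}" for v by (auto simp: coset_def)
  then have pt: "pt (coset l S W v) \<in> coset l S W v" for v
    unfolding pt_def by (simp add: some_in_eq)
  have "\<exists>u. u \<in> row_lattice g S A \<and> (\<forall>i<m. \<forall>j<n. u (bip_edge i j) = \<epsilon> i j * (p i y + q j y))" for y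
    using lat[of "\<lambda>i. p i y" "\<lambda>j. q j y"] by (simp only: Bex_def)
  then have "\<exists>L. \<forall>y. L y \<in> row_lattice g S A \<and> (\<forall>i<m. \<forall>j<n. L y (bip_edge i j) = \<epsilon> i j * (p i y + q j y))"
    by (intro choice allI)
  then obtain L where L': "\<forall>y. L y \<in> row_lattice g S A \<and> (\<forall>i<m. \<forall>j<n. L y (bip_edge i j) = \<epsilon> i j * (p i y + q j y))" ..
  have L: "L y \<in> row_lattice g S A" "i < m \<Longrightarrow> j < n \<Longrightarrow> L y (bip_edge i j) = \<epsilon> i j * (p i y + q j y)" for y i j
    using L' by simp_all
  define F where "F x = reduce l S (L (Y (pt x)))" for x
  have F_coset: "[F (coset l S W v) (bip_edge i j) = \<epsilon> i j * (p i (Y v) + q j (Y v))] (mod int l)"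
    if ij: "i < m" "j < n" for v i j
  proof -
    have "[F (coset l S W v) (bip_edge i j) = L (Y (pt (coset l S W v))) (bip_edge i j)] (mod int l)"
      unfolding F_def by (rule reduce_cong) (use ij in simp)
    moreover have "[L (Y (pt (coset l S W v))) (bip_edge i j) = \<epsilon> i j * (p i (Y v) + q j (Y v))] (mod int l)"
      unfolding L(2)[OF ij] by (intro cong_mult cong_add cong_refl p q Y_coset[OF pt])
    ultimately show ?thesis by (rule cong_trans)
  qed
  define \<gamma>' where "\<gamma>' s = \<gamma> (THE i. Inl i \<in> s) (THE j. Inr j \<in> s)" for s
  have \<gamma>': "\<gamma>' (bip_edge i j) = \<gamma> i j" for i j
    by (simp add: \<gamma>'_def)
  have "[(\<Sum>s\<in>S. \<gamma>' s * color_profile l S (Alb_edges l S W) (b s) s) = 0] (mod int l)"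
  proof (rule solution_certificate[OF l _ sol W_def, of F])
    show "F x \<in> W" for x unfolding F_def W_def row_lattice_mod_def by (intro imageI L(1))
    fix e assume "e \<in> Alb_edges l S W"
    then obtain v where v: "tail e = coset l S W v" "head e = coset l S W (v(color e := v (color e) + 1))" "color e \<in> S"
      by (rule Alb_edgesE)
    then obtain i j where ij: "color e = bip_edge i j" "i < m" "j < n" by (auto simp: bip_edges_def)
    have hd: "Y (v(color e := v (color e) + 1)) = (\<lambda>a b. Y v a b + \<epsilon> i j * unit_coords i j a b)"
      unfolding ij(1) Y_step ..
    have diff: "[F (head e) (color e) - F (tail e) (color e) =
        \<epsilon> i j * (p i (\<lambda>a b. Y v a b + \<epsilon> i j * unit_coords i j a b) + q j (\<lambda>a b. Y v a b + \<epsilon> i j * unit_coords i j a b))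
        - \<epsilon> i j * (p i (Y v) + q j (Y v))] (mod int l)"
      using cong_diff[OF F_coset[OF ij(2,3), of "v(color e := v (color e) + 1)"] F_coset[OF ij(2,3), of v]]
      unfolding hd v(1,2)[symmetric] ij(1)[symmetric] .
    have "[\<epsilon> i j * (p i (\<lambda>a b. Y v a b + \<epsilon> i j * unit_coords i j a b) + q j (\<lambda>a b. Y v a b + \<epsilon> i j * unit_coords i j a b))
        - \<epsilon> i j * (p i (Y v) + q j (Y v)) = \<gamma> i j] (mod int l)"
    proof (cases "\<epsilon> i j = 1")
      case True
      have "[p i (\<lambda>a b. Y v a b + unit_coords i j a b) + q j (\<lambda>a b. Y v a b + unit_coords i j a b) - (p i (Y v) + q j (Y v))
          = (p i (Y v) + q j (Y v) + \<gamma> i j) - (p i (Y v) + q j (Y v))] (mod int l)"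
        by (intro cong_diff step[OF ij(2,3)] cong_refl)
      then show ?thesis by (simp add: True)
    next
      case False
      then have neg: "\<epsilon> i j = -1" using \<epsilon>[OF ij(2,3)] by simp
      \<comment> \<open>A negative column sign reverses the move in coordinates. So
        \<open>step\<close> is used from the head's coordinates \<open>y\<close> back to
        \<open>Y v\<close>, and the outer sign restores \<open>\<gamma> i j\<close>.\<close>
      define y where "y = (\<lambda>a b. Y v a b - unit_coords i j a b)"
      have y: "(\<lambda>a b. y a b + unit_coords i j a b) = Y v" "(\<lambda>a b. Y v a b + - 1 * unit_coords i j a b) = y"
        by (simp_all add: y_def)
      have st: "[p i (Y v) + q j (Y v) - (p i y + q j y) = (p i y + q j y + \<gamma> i j) - (p i y + q j y)] (mod int l)"
        using step[OF ij(2,3), of y] unfolding y(1) by (intro cong_diff cong_refl)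
      have eq: "- 1 * (p i y + q j y) - - 1 * (p i (Y v) + q j (Y v)) = p i (Y v) + q j (Y v) - (p i y + q j y)"
        by simp
      show ?thesis unfolding neg y(2) eq using st by simp
    qed
    from cong_trans[OF diff this]
    show "[F (head e) (color e) - F (tail e) (color e) = \<gamma>' (color e)] (mod int l)"
      by (simp only: ij(1) \<gamma>')
  qed simp
  moreover have "(\<Sum>s\<in>S. \<gamma>' s * color_profile l S (Alb_edges l S W) (b s) s) = c * (\<Sum>i<m. \<Sum>j<n. \<gamma> i j)"
  proof -
    have "(\<Sum>s\<in>S. \<gamma>' s * color_profile l S (Alb_edges l S W) (b s) s) = (\<Sum>s\<in>S. \<gamma>' s * c)"
      using prof unfolding W_def by simp
    also have "\<dots> = c * (\<Sum>i<m. \<Sum>j<n. \<gamma> i j)"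
      by (simp add: sum_bip_edges \<gamma>' sum_distrib_left mult.commute)
    finally show ?thesis .
  qed
  ultimately show ?thesis by simp
qed

text \<open>With \<open>N = 2l - 2\<close>, \<open>a = (y\<^sub>1\<^sub>1, \<dots>, y\<^sub>1\<^sub>N)\<close>, \<open>b = (y\<^sub>2\<^sub>1, \<dots>, y\<^sub>2\<^sub>N)\<close> and elementary symmetric
  polynomials \<open>e\<^sub>k\<close>, the potentials for \<open>l = 2, 3\<close> are \<open>p\<^sub>0 = 0\<close>, \<open>p\<^sub>1 = - e\<^sub>l(a)\<close>,
  \<open>p\<^sub>2 = \<Sum>\<^sub>j b\<^sub>j e(j)\<close>, \<open>q\<^sub>j = (a\<^sub>j - b\<^sub>j) e(j)\<close> for \<open>1 \<le> j \<le> N\<close> and \<open>q\<^sub>0 = (b\<^sub>1 - a\<^sub>1) e\<^sub>l\<^sub>-\<^sub>1(a) + a\<^sub>1\<close>, where \<open>e(j)\<close> is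
  \<open>e\<^sub>l\<^sub>-\<^sub>1\<close> of the entries of \<open>a\<close> other than \<open>a\<^sub>j\<close>.\<close>

definition pot2_row :: "nat \<Rightarrow> (nat \<Rightarrow> nat \<Rightarrow> int) \<Rightarrow> int" where
  "pot2_row i y =
     (if i = 1 then - (y 1 1 * y 1 2) else if i = 2 then y 2 1 * y 1 2 + y 2 2 * y 1 1 else 0)"

definition pot2_col :: "nat \<Rightarrow> (nat \<Rightarrow> nat \<Rightarrow> int) \<Rightarrow> int" where
  "pot2_col j y =
     (if j = 0 then (y 2 1 - y 1 1) * (y 1 1 + y 1 2) + y 1 1
      else if j = 1 then (y 1 1 - y 2 1) * y 1 2
      else if j = 2 then (y 1 2 - y 2 2) * y 1 1 else 0)"

definition esym2 :: "int \<Rightarrow> int \<Rightarrow> int \<Rightarrow> int" where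
  "esym2 a b c = a * b + a * c + b * c"

definition pot3_row :: "nat \<Rightarrow> (nat \<Rightarrow> nat \<Rightarrow> int) \<Rightarrow> int" where
  "pot3_row i y =
     (if i = 1 then - (y 1 1 * y 1 2 * y 1 3 + y 1 4 * esym2 (y 1 1) (y 1 2) (y 1 3))
      else if i = 2 then y 2 1 * esym2 (y 1 2) (y 1 3) (y 1 4) + y 2 2 * esym2 (y 1 1) (y 1 3) (y 1 4)
        + y 2 3 * esym2 (y 1 1) (y 1 2) (y 1 4) + y 2 4 * esym2 (y 1 1) (y 1 2) (y 1 3)
      else 0)"

definition pot3_col :: "nat \<Rightarrow> (nat \<Rightarrow> nat \<Rightarrow> int) \<Rightarrow> int" where
  "pot3_col j y =
     (if j = 0 then (y 2 1 - y 1 1) * (esym2 (y 1 1) (y 1 2) (y 1 3) + y 1 4 * (y 1 1 + y 1 2 + y 1 3)) + y 1 1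
      else if j = 1 then (y 1 1 - y 2 1) * esym2 (y 1 2) (y 1 3) (y 1 4)
      else if j = 2 then (y 1 2 - y 2 2) * esym2 (y 1 1) (y 1 3) (y 1 4)
      else if j = 3 then (y 1 3 - y 2 3) * esym2 (y 1 1) (y 1 2) (y 1 4)
      else (y 1 4 - y 2 4) * esym2 (y 1 1) (y 1 2) (y 1 3))"

lemma less_3_cases: "(i :: nat) < 3 \<Longrightarrow> i = 0 \<or> i = 1 \<or> i = 2" by auto

lemma less_5_cases: "(j :: nat) < 5 \<Longrightarrow> j = 0 \<or> j = 1 \<or> j = 2 \<or> j = 3 \<or> j = 4" by auto

text \<open>For \<open>j \<noteq> 0\<close> the identity is exact. A move in column 0 shifts whole
  rows, which changes \<open>y 1 1 + y 1 2\<close> by 0, 2 or -2. At the edge \<open>(0, 0)\<close>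
  the summand \<open>y 1 1\<close> of \<open>pot2_col\<close> leaves the 1.\<close>

lemma pot2_step:
  assumes "i < 3" "j < 5"
  shows "\<exists>w. pot2_row i (\<lambda>a b. y a b + unit_coords i j a b) + pot2_col j (\<lambda>a b. y a b + unit_coords i j a b) =
    pot2_row i y + pot2_col j y + of_bool (i = 0 \<and> j = 0) + 2 * w"
proof -
  define w where "w = (if j = 0 then
      if i = 0 then y 2 1 - y 1 1
      else if i = 1 then 2 * y 1 1 + y 1 2 - y 2 1 - 2 else - (y 1 1 + y 1 2) else 0)"
  show ?thesis
    using less_3_cases[OF assms(1)] less_5_cases[OF assms(2)]
    by (intro exI[of _ w], elim disjE)
      (simp_all add: w_def pot2_row_def pot2_col_def unit_coords_def algebra_simps)
qed

text \<open>Here \<open>e1\<close> and \<open>e2\<close> are the elementary symmetric polynomials of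
  \<open>y 1 1\<close> to \<open>y 1 4\<close>. Adding 1 to all four variables changes
  \<open>e2\<close> by \<open>3 * e1 + 6\<close>, so \<open>e2\<close> is stable modulo 3. Again
  only column 0 leaves a multiple of 3.\<close>

lemma pot3_step:
  assumes "i < 3" "j < 5"
  shows "\<exists>w. pot3_row i (\<lambda>a b. y a b + unit_coords i j a b) + pot3_col j (\<lambda>a b. y a b + unit_coords i j a b) =
    pot3_row i y + pot3_col j y + of_bool (i = 0 \<and> j = 0) + 3 * w"
proof -
  define e1 where "e1 = y 1 1 + y 1 2 + y 1 3 + y 1 4"
  define e2 where "e2 = esym2 (y 1 1) (y 1 2) (y 1 3) + y 1 4 * (y 1 1 + y 1 2 + y 1 3)"
  define w where "w = (if j = 0 then
      if i = 0 then (y 2 1 - y 1 1) * (e1 + 2)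
      else if i = 1 then e2 - 2 * e1 + 3 + (y 2 1 - y 1 1) * (2 - e1) else - e2 else 0)"
  show ?thesis
    using less_3_cases[OF assms(1)] less_5_cases[OF assms(2)]
    by (intro exI[of _ w], elim disjE)
      (simp_all add: w_def e1_def e2_def pot3_row_def pot3_col_def esym2_def unit_coords_def algebra_simps)
qed

text \<open>With \<gamma> the indicator of the edge \<open>(0, 0)\<close>, the certificate says that
  the common profile \<open>c\<close> is zero modulo \<open>l\<close>. It is applied to the
  realization that comes with the alleged solution.\<close>

lemma not_matroid_class_if_potentials:
  fixes p q :: "nat \<Rightarrow> (nat \<Rightarrow> nat \<Rightarrow> int) \<Rightarrow> int"
  assumes mn: "2 \<le> m" "2 \<le> n" and l: "0 < l"
    and p: "\<And>i y y'. (\<And>a b. a < m \<Longrightarrow> b < n \<Longrightarrow> [y a b = y' a b] (mod int l)) \<Longrightarrow> [p i y = p i y'] (mod int l)"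
    and q: "\<And>j y y'. (\<And>a b. a < m \<Longrightarrow> b < n \<Longrightarrow> [y a b = y' a b] (mod int l)) \<Longrightarrow> [q j y = q j y'] (mod int l)"
    and step: "\<And>i j y. i < m \<Longrightarrow> j < n \<Longrightarrow> \<exists>w.
      p i (\<lambda>a b. y a b + unit_coords i j a b) + q j (\<lambda>a b. y a b + unit_coords i j a b) =
      p i y + q j y + of_bool (i = 0 \<and> j = 0) + int l * w"
  shows "cycle_matroid (complete_bipartite m n) \<notin> matroid_class l"
proof
  assume "cycle_matroid (complete_bipartite m n) \<in> matroid_class l"
  then obtain g A b c where real: "realizes g A (cycle_matroid (complete_bipartite m n))"
    and sol: "is_solution l g (bip_edges m n) A b" and c: "c \<in> Fl l - {0}"
    and prof: "\<forall>s\<in>bip_edges m n. color_profile l (bip_edges m n)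
      (Alb_edges l (bip_edges m n) (row_lattice_mod l g (bip_edges m n) A)) (b s) s = c"
    unfolding matroid_class_def by (auto simp: ground_cycle_matroid_bip)
  interpret bip_realization m n g A
    by unfold_locales (use mn real in auto)
  have "[c * (\<Sum>i<m. \<Sum>j<n. of_bool (i = 0 \<and> j = 0)) = 0] (mod int l)"
  proof (rule solution_potential_certificate[OF l p q _ sol])
    show "[p i (\<lambda>a b. y a b + unit_coords i j a b) + q j (\<lambda>a b. y a b + unit_coords i j a b) =
        p i y + q j y + of_bool (i = 0 \<and> j = 0)] (mod int l)" if ij: "i < m" "j < n" for i j y
    proof -
      from step[OF ij, of y] obtain w where
        "p i (\<lambda>a b. y a b + unit_coords i j a b) + q j (\<lambda>a b. y a b + unit_coords i j a b) =
         p i y + q j y + of_bool (i = 0 \<and> j = 0) + int l * w" ..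
      then show ?thesis by (simp add: cong_def)
    qed
  qed (use prof in auto)
  moreover have "(\<Sum>i<m. \<Sum>j<n. of_bool (i = 0 \<and> j = 0)) = (1 :: int)"
  proof -
    have "(\<Sum>i<m. \<Sum>j<n. of_bool (i = 0 \<and> j = 0)) = (\<Sum>i<m. if i = 0 then \<Sum>j<n. if j = 0 then 1 else 0 else (0 :: int))"
      by (intro sum.cong refl) auto
    then show ?thesis using mn by simp
  qed
  ultimately show False using c by (simp add: cong_def Fl_def)
qed

lemma K35_not_mem_matroid_class_2: "cycle_matroid (complete_bipartite 3 5) \<notin> matroid_class 2"
proof (rule not_matroid_class_if_potentials[where p = pot2_row and q = pot2_col])
  fix y y' :: "nat \<Rightarrow> nat \<Rightarrow> int" and k
  assume y: "\<And>a b. a < 3 \<Longrightarrow> b < 5 \<Longrightarrow> [y a b = y' a b] (mod int 2)"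
  show "[pot2_row k y = pot2_row k y'] (mod int 2)"
    unfolding pot2_row_def
    by (auto intro!: cong_add cong_mult y[simplified] simp: cong_minus_minus_iff)
  show "[pot2_col k y = pot2_col k y'] (mod int 2)"
    unfolding pot2_col_def by (auto intro!: cong_add cong_mult cong_diff y[simplified])
qed (use pot2_step in auto)

lemma K35_not_mem_matroid_class_3: "cycle_matroid (complete_bipartite 3 5) \<notin> matroid_class 3"
proof (rule not_matroid_class_if_potentials[where p = pot3_row and q = pot3_col])
  fix y y' :: "nat \<Rightarrow> nat \<Rightarrow> int" and k
  assume y: "\<And>a b. a < 3 \<Longrightarrow> b < 5 \<Longrightarrow> [y a b = y' a b] (mod int 3)"
  show "[pot3_row k y = pot3_row k y'] (mod int 3)"
    unfolding pot3_row_def esym2_def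
    by (auto intro!: cong_add cong_mult cong_diff y[simplified] simp: cong_minus_minus_iff)
  show "[pot3_col k y = pot3_col k y'] (mod int 3)"
    unfolding pot3_col_def esym2_def by (auto intro!: cong_add cong_mult cong_diff y[simplified])
qed (use pot3_step in auto)

section \<open>Solutions from the integral group ring\<close>

lemma sum_sum_list_swap:
  fixes f :: "'x \<Rightarrow> 'e \<Rightarrow> 'a::comm_monoid_add"
  shows "(\<Sum>e\<in>E. \<Sum>x\<leftarrow>xs. f x e) = (\<Sum>x\<leftarrow>xs. \<Sum>e\<in>E. f x e)"
  by (induction xs) (auto simp: sum.distrib)

text \<open>Only the rows 0, \<open>i\<close> and \<open>m + j - 1\<close> meet the column of
  \<open>(i, j)\<close>, and the \<open>of_bool\<close> factors suppress the last two when
  \<open>i\<close> or \<open>j\<close> is 0. The grouping exhibits the potentials.\<close>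

lemma sum_cut_matrix:
  assumes ij: "i < m" "j < n"
  shows "(\<Sum>k<m + n - 1. z k * cut_matrix m k (bip_edge i j)) =
    (z 0 * (of_bool (i = 0) - 1) + of_bool (0 < i) * z i) +
    (z 0 * of_bool (j = 0) + of_bool (0 < j) * z (m + j - 1))"
proof -
  have "(\<Sum>k<m + n - 1. z k * cut_matrix m k (bip_edge i j)) =
      (\<Sum>k<m + n - 1. (if k = 0 then z 0 * (of_bool (i = 0) + of_bool (j = 0) - 1) else 0)
        + (if k = i then of_bool (0 < i) * z i else 0)
        + (if k = m + j - 1 then of_bool (0 < j) * z (m + j - 1) else 0))"
    by (intro sum.cong refl) (use ij in \<open>auto simp: cut_matrix_def\<close>)
  also have "\<dots> = z 0 * (of_bool (i = 0) + of_bool (j = 0) - 1) + of_bool (0 < i) * z i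
      + of_bool (0 < j) * z (m + j - 1)"
  proof -
    have "0 < m + n - 1" "i < m + n - 1" "m + j - 1 < m + n - 1" using ij by auto
    then show ?thesis by (simp add: sum.distrib del: One_nat_def)
  qed
  finally show ?thesis by (simp add: algebra_simps)
qed

section \<open>Cuts as matrices of potentials, and equality of cosets\<close>

lemma row_lattice_cut_matrix_potentials:
  assumes "u \<in> row_lattice (m + n - 1) (bip_edges m n) (cut_matrix m)"
  shows "\<exists>p q. \<forall>i<m. \<forall>j<n. u (bip_edge i j) = p i + q j"
proof -
  obtain z where u: "u = (\<lambda>s\<in>bip_edges m n. \<Sum>k<m + n - 1. z k * cut_matrix m k s)"
    using assms unfolding row_lattice_def by blast
  show ?thesis
    by (rule exI[of _ "\<lambda>i. z 0 * (of_bool (i = 0) - 1) + of_bool (0 < i) * z i"],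
        rule exI[of _ "\<lambda>j. z 0 * of_bool (j = 0) + of_bool (0 < j) * z (m + j - 1)"])
      (simp add: u sum_cut_matrix del: One_nat_def)
qed

lemma potentials_row_lattice_cut_matrix:
  assumes "0 < m" "0 < n"
  shows "\<exists>u \<in> row_lattice (m + n - 1) (bip_edges m n) (cut_matrix m).
    \<forall>i<m. \<forall>j<n. u (bip_edge i j) = p i + q j"
proof -
  \<comment> \<open>\<open>cut_matrix\<close> is the identity on the tree edges, so the coefficients
    are the values of the potential matrix there.\<close>
  define z where "z k = (if k < m then p k + q 0 else p 0 + q (k - m + 1))" for k
  define u where "u = (\<lambda>s\<in>bip_edges m n. \<Sum>k<m + n - 1. z k * cut_matrix m k s)"
  have "u (bip_edge i j) = p i + q j" if ij: "i < m" "j < n" for i j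
  proof -
    have "u (bip_edge i j) = (z 0 * (of_bool (i = 0) - 1) + of_bool (0 < i) * z i) +
        (z 0 * of_bool (j = 0) + of_bool (0 < j) * z (m + j - 1))"
      using ij by (simp add: u_def sum_cut_matrix del: One_nat_def)
    also have "\<dots> = p i + q j"
      using ij assms by (cases "i = 0"; cases "j = 0") (auto simp: z_def)
    finally show ?thesis .
  qed
  moreover have "u \<in> row_lattice (m + n - 1) (bip_edges m n) (cut_matrix m)"
    unfolding row_lattice_def u_def by blast
  ultimately show ?thesis by blast
qed

lemma coset_eq_if_potentials:
  assumes mn: "0 < m" "0 < n"
    and W: "W = row_lattice_mod l (m + n - 1) (bip_edges m n) (cut_matrix m)"
    and v: "\<And>i j. i < m \<Longrightarrow> j < n \<Longrightarrow> [v (bip_edge i j) = v' (bip_edge i j) + p i + q j] (mod int l)"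
  shows "coset l (bip_edges m n) W v = coset l (bip_edges m n) W v'"
proof -
  let ?S = "bip_edges m n"
  have sub: "coset l ?S W v \<subseteq> coset l ?S W v'"
    if v: "\<And>i j. i < m \<Longrightarrow> j < n \<Longrightarrow> [v (bip_edge i j) = v' (bip_edge i j) + p i + q j] (mod int l)" for v v' p q
  proof
    fix x assume "x \<in> coset l ?S W v"
    then obtain r where r: "r \<in> row_lattice (m + n - 1) ?S (cut_matrix m)"
      and x: "x = reduce l ?S (\<lambda>s. v s + reduce l ?S r s)"
      unfolding coset_def W row_lattice_mod_def by auto
    from row_lattice_cut_matrix_potentials[OF r] obtain p' q'
      where r': "\<And>i j. i < m \<Longrightarrow> j < n \<Longrightarrow> r (bip_edge i j) = p' i + q' j" by blast
    from potentials_row_lattice_cut_matrix[OF mn, of "\<lambda>i. p i + p' i" "\<lambda>j. q j + q' j"] obtain u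
      where u: "u \<in> row_lattice (m + n - 1) ?S (cut_matrix m)"
      and u': "\<And>i j. i < m \<Longrightarrow> j < n \<Longrightarrow> u (bip_edge i j) = p i + p' i + (q j + q' j)" by blast
    have "(v s + reduce l ?S r s) mod int l = (v' s + reduce l ?S u s) mod int l" if s: "s \<in> ?S" for s
    proof -
      obtain i j where ij: "s = bip_edge i j" "i < m" "j < n" using s by (auto simp: bip_edges_def)
      have "[v s + reduce l ?S r s = (v' s + p i + q j) + r s] (mod int l)"
        using v[OF ij(2,3)] reduce_cong[OF s] unfolding ij(1) by (rule cong_add)
      also have "(v' s + p i + q j) + r s = v' s + u s"
        unfolding ij(1) r'[OF ij(2,3)] u'[OF ij(2,3)] by simp
      also have "[v' s + u s = v' s + reduce l ?S u s] (mod int l)"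
        by (rule cong_add[OF cong_refl cong_sym[OF reduce_cong[OF s]]])
      finally show ?thesis by (simp add: cong_def)
    qed
    then have "x = reduce l ?S (\<lambda>s. v' s + reduce l ?S u s)"
      unfolding x reduce_def[of l ?S "\<lambda>s. v s + _ s"] reduce_def[of l ?S "\<lambda>s. v' s + _ s"]
      by (intro restrict_ext)
    then show "x \<in> coset l ?S W v'"
      using u unfolding coset_def W row_lattice_mod_def by blast
  qed
  have "[v' (bip_edge i j) = v (bip_edge i j) + - p i + - q j] (mod int l)" if "i < m" "j < n" for i j
  proof -
    have "[v (bip_edge i j) + - p i + - q j = (v' (bip_edge i j) + p i + q j) + - p i + - q j] (mod int l)"
      by (intro cong_add cong_refl v that)
    from cong_sym[OF this] show ?thesis by simp
  qed
  then show ?thesis using sub[of v v' p q] sub[of v' v "\<lambda>i. - p i" "\<lambda>j. - q j"] v by blast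
qed

text \<open>A list of pairs stands for a formal integer combination, and its vanishing is tested by
  pairing with every \<open>f\<close>. The indicator of the keys over a vertex \<open>x\<close>
  yields the boundary at \<open>x\<close>. Since cuts have the form \<open>p i + q j\<close>, the
  row and column equations give closedness.\<close>

theorem ex_solution_if_formal_solution:
  fixes T :: "nat \<Rightarrow> nat \<Rightarrow> (int \<times> 'k) list" and crd :: "'k \<Rightarrow> nat \<Rightarrow> nat \<Rightarrow> int"
  assumes mn: "0 < m" "0 < n" and l: "0 < l"
    and sh: "\<And>i j x a b. i < m \<Longrightarrow> j < n \<Longrightarrow> x \<in> set (T i j) \<Longrightarrow> a < m \<Longrightarrow> b < n \<Longrightarrow>
      crd (sh i j (snd x)) a b = crd (snd x) a b + unit_coords i j a b"
    and rows: "\<And>i f. i < m \<Longrightarrow> (\<Sum>j<n. \<Sum>x\<leftarrow>T i j. fst x * (f (sh i j (snd x)) - f (snd x))) = (0 :: int)"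
    and cols: "\<And>j f. j < n \<Longrightarrow> (\<Sum>i<m. \<Sum>x\<leftarrow>T i j. fst x * (f (sh i j (snd x)) - f (snd x))) = (0 :: int)"
    and aug: "\<And>i j. i < m \<Longrightarrow> j < n \<Longrightarrow> sum_list (map fst (T i j)) = C"
  shows "\<exists>b. is_solution l (m + n - 1) (bip_edges m n) (cut_matrix m) b \<and>
    (\<forall>s\<in>bip_edges m n. color_profile l (bip_edges m n)
       (Alb_edges l (bip_edges m n) (row_lattice_mod l (m + n - 1) (bip_edges m n) (cut_matrix m))) (b s) s
       = C mod int l)"
proof -
  let ?S = "bip_edges m n"
  define W where "W = row_lattice_mod l (m + n - 1) ?S (cut_matrix m)"
  define E where "E = Alb_edges l ?S W"
  have finE: "finite E" by (simp add: E_def finite_Alb_edges)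
  define li where "li s = (THE i. Inl i \<in> s)" for s :: "(nat + nat) set"
  define ri where "ri s = (THE j. Inr j \<in> s)" for s :: "(nat + nat) set"
  have liri [simp]: "li (bip_edge i j) = i" "ri (bip_edge i j) = j" for i j
    by (simp_all add: li_def ri_def)
  define vec where "vec k s = crd k (li s) (ri s)" for k s
  define pt where "pt k = coset l ?S W (vec k)" for k
  define ed where "ed i j k = (pt k, bip_edge i j, pt (sh i j k))" for i j k
  have ed_mem: "ed i j (snd x) \<in> E" if ij: "i < m" "j < n" and x: "x \<in> set (T i j)" for i j x
  proof -
    let ?s = "bip_edge i j" and ?v = "reduce l ?S (vec (snd x))"
    \<comment> \<open>The matrix unit at \<open>(i, j)\<close> and \<open>unit_coords i j\<close>
      differ by a cut, whose potentials are given as \<open>p\<close> and \<open>q\<close>.\<close>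
    have "coset l ?S W (?v(?s := ?v ?s + 1)) = pt (sh i j (snd x))"
      unfolding pt_def
    proof (rule coset_eq_if_potentials[OF mn W_def,
          where p = "\<lambda>a. of_bool (a = i) * of_bool (j = 0) - of_bool (i = 0) * of_bool (j = 0)"
            and q = "\<lambda>b. of_bool (b = j) * of_bool (i = 0)"])
      fix a b assume ab: "a < m" "b < n"
      have "[(?v(?s := ?v ?s + 1)) (bip_edge a b) = vec (snd x) (bip_edge a b) + of_bool (a = i \<and> b = j)] (mod int l)"
        using reduce_cong[of "bip_edge a b" ?S l "vec (snd x)"] ab by (auto intro: cong_add)
      moreover have "vec (snd x) (bip_edge a b) + of_bool (a = i \<and> b = j) = vec (sh i j (snd x)) (bip_edge a b)
        + (of_bool (a = i) * of_bool (j = 0) - of_bool (i = 0) * of_bool (j = 0)) + of_bool (b = j) * of_bool (i = 0)"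
        using sh[OF ij x ab] by (auto simp: vec_def unit_coords_def)
      ultimately show "[(?v(?s := ?v ?s + 1)) (bip_edge a b) = vec (sh i j (snd x)) (bip_edge a b)
        + (of_bool (a = i) * of_bool (j = 0) - of_bool (i = 0) * of_bool (j = 0)) + of_bool (b = j) * of_bool (i = 0)] (mod int l)"
        by simp
    qed
    moreover have "coset l ?S W ?v = pt (snd x)" unfolding pt_def by (rule coset_reduce)
    moreover have "(coset l ?S W ?v, ?s, coset l ?S W (?v(?s := ?v ?s + 1))) \<in> E"
      unfolding E_def Alb_edges_image
      by (rule image_eqI[of _ _ "(?v, ?s)"]) (use reduce_mem[OF l, of ?S] ij in simp_all)
    ultimately show ?thesis unfolding ed_def by simp
  qed
  define B where "B i j e = (\<Sum>x\<leftarrow>T i j. fst x * of_bool (e = ed i j (snd x)))" for i j e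
  define b where "b s = (\<lambda>e\<in>E. B (li s) (ri s) e mod int l)" for s
  have B_sum: "(\<Sum>e\<in>E'. B i j e * \<phi> e) = (\<Sum>x\<leftarrow>T i j. fst x * \<phi> (ed i j (snd x)))"
    if "i < m" "j < n" "finite E'" and E': "\<And>x. x \<in> set (T i j) \<Longrightarrow> ed i j (snd x) \<in> E'" for i j \<phi> E'
  proof -
    have "(\<Sum>e\<in>E'. B i j e * \<phi> e) = (\<Sum>x\<leftarrow>T i j. \<Sum>e\<in>E'. fst x * of_bool (e = ed i j (snd x)) * \<phi> e)"
      unfolding B_def sum_list_mult_const[symmetric] by (rule sum_sum_list_swap)
    also have "\<dots> = (\<Sum>x\<leftarrow>T i j. fst x * \<phi> (ed i j (snd x)))"
    proof (intro arg_cong[of _ _ sum_list] map_cong refl)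
      fix x assume "x \<in> set (T i j)"
      then have "ed i j (snd x) \<in> E'" by (rule E')
      then show "(\<Sum>e\<in>E'. fst x * of_bool (e = ed i j (snd x)) * \<phi> e) = fst x * \<phi> (ed i j (snd x))"
        using \<open>finite E'\<close> by (subst sum.remove[of _ "ed i j (snd x)"]) (auto intro!: sum.neutral)
    qed
    finally show ?thesis .
  qed
  have "is_solution l (m + n - 1) ?S (cut_matrix m) b"
    unfolding is_solution_def Let_def W_def[symmetric] E_def[symmetric]
  proof (intro conjI ballI impI)
    fix s assume s: "s \<in> ?S"
    show "b s \<in> chains l E" using l by (auto simp: b_def chains_def Fl_def)
    fix e assume e: "e \<in> E" "color e \<noteq> s"
    from s obtain i j where ij: "s = bip_edge i j" by (auto simp: bip_edges_def)
    have "B i j e = (\<Sum>x\<leftarrow>T i j. 0)"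
      unfolding B_def by (intro arg_cong[of _ _ sum_list] map_cong refl) (use e ij in \<open>auto simp: ed_def\<close>)
    then show "b s e = 0" using e by (simp add: b_def ij)
  next
    fix c assume c: "c \<in> W"
    then obtain r where r: "r \<in> row_lattice (m + n - 1) ?S (cut_matrix m)" and cr: "c = reduce l ?S r"
      unfolding W_def row_lattice_mod_def by blast
    from row_lattice_cut_matrix_potentials[OF r] obtain p q
      where pq: "\<And>i j. i < m \<Longrightarrow> j < n \<Longrightarrow> r (bip_edge i j) = p i + q j" by blast
    show "closed_chain l (Alb_verts l ?S W) E (lin_comb l ?S E c b)"
      unfolding closed_chain_def
    proof
      fix x
      define \<delta> where "\<delta> e = (of_bool (head e = x) - of_bool (tail e = x) :: int)" for e :: "(nat + nat) set edge"
      define D where "D i j = (\<Sum>y\<leftarrow>T i j. fst y * (of_bool (pt (sh i j (snd y)) = x) - of_bool (pt (snd y) = x)))" for i j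
      have D: "(\<Sum>e\<in>E. B i j e * \<delta> e) = D i j" if "i < m" "j < n" for i j
        using B_sum[OF that finE ed_mem[OF that], of \<delta>] by (simp add: D_def \<delta>_def ed_def)
      have "[boundary E (lin_comb l ?S E c b) x = (\<Sum>e\<in>E. (\<Sum>i<m. \<Sum>j<n. (p i + q j) * B i j e) * \<delta> e)] (mod int l)"
        unfolding boundary_def \<delta>_def
      proof (intro cong_sum cong_mult cong_refl)
        fix e assume e: "e \<in> E"
        have "[lin_comb l ?S E c b e = (\<Sum>s\<in>?S. c s * b s e)] (mod int l)"
          using e by (simp add: lin_comb_def cong_def)
        also have "(\<Sum>s\<in>?S. c s * b s e) = (\<Sum>i<m. \<Sum>j<n. c (bip_edge i j) * b (bip_edge i j) e)"
          by (rule sum_bip_edges)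
        also have "[(\<Sum>i<m. \<Sum>j<n. c (bip_edge i j) * b (bip_edge i j) e) = (\<Sum>i<m. \<Sum>j<n. (p i + q j) * B i j e)] (mod int l)"
        proof (intro cong_sum cong_mult)
          fix i j assume "i \<in> {..<m}" "j \<in> {..<n}"
          then show "[c (bip_edge i j) = p i + q j] (mod int l)"
            using reduce_cong[of "bip_edge i j" ?S l r] pq[of i j] by (simp add: cr)
          show "[b (bip_edge i j) e = B i j e] (mod int l)"
            using e by (simp add: b_def cong_def)
        qed
        finally show "[lin_comb l ?S E c b e = (\<Sum>i<m. \<Sum>j<n. (p i + q j) * B i j e)] (mod int l)" .
      qed
      also have "(\<Sum>e\<in>E. (\<Sum>i<m. \<Sum>j<n. (p i + q j) * B i j e) * \<delta> e) =
          (\<Sum>i<m. \<Sum>j<n. (p i + q j) * (\<Sum>e\<in>E. B i j e * \<delta> e))"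
        unfolding sum_distrib_right sum_distrib_left
        by (subst sum.swap, intro sum.cong refl, subst sum.swap) (simp add: mult.assoc)
      also have "\<dots> = (\<Sum>i<m. \<Sum>j<n. (p i + q j) * D i j)"
        by (intro sum.cong refl) (simp add: D)
      also have "\<dots> = (\<Sum>i<m. p i * (\<Sum>j<n. D i j)) + (\<Sum>j<n. q j * (\<Sum>i<m. D i j))"
        unfolding distrib_right sum.distrib sum_distrib_left by (subst (3) sum.swap) simp
      also have "\<dots> = 0"
        using rows[of _ "\<lambda>k. of_bool (pt k = x)"] cols[of _ "\<lambda>k. of_bool (pt k = x)"]
        by (simp add: D_def)
      finally show "boundary E (lin_comb l ?S E c b) x mod int l = 0" by (simp add: cong_def)
    qed
  qed
  moreover have "color_profile l ?S E (b s) s = C mod int l" if s: "s \<in> ?S" for s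
  proof -
    from s obtain i j where ij: "s = bip_edge i j" "i < m" "j < n" by (auto simp: bip_edges_def)
    have "[(\<Sum>e\<in>{e\<in>E. color e = s}. b s e) = (\<Sum>e\<in>{e\<in>E. color e = s}. B i j e * 1)] (mod int l)"
      by (intro cong_sum) (simp add: b_def ij cong_def)
    also have "(\<Sum>e\<in>{e\<in>E. color e = s}. B i j e * 1) = (\<Sum>x\<leftarrow>T i j. fst x * 1)"
      by (rule B_sum[OF ij(2,3)]) (use finE ed_mem[OF ij(2,3)] in \<open>auto simp: ed_def ij\<close>)
    also have "\<dots> = C" using aug[OF ij(2,3)] by simp
    finally show ?thesis using s by (simp add: color_profile_def reduce_def cong_def)
  qed
  ultimately show ?thesis unfolding E_def W_def by blast
qed

section \<open>An integral solution for the graph K(3,5)\<close>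

text \<open>The coordinates \<open>y\<^sub>1\<^sub>b\<close> and \<open>y\<^sub>2\<^sub>b\<close> for \<open>b = 1, \<dots>, 4\<close>.\<close>

type_synonym point = "int list \<times> int list"

text \<open>Column \<open>b\<close> sits at list position \<open>b - 1\<close>; row 0 and column 0
  carry the normalized value 0.\<close>

fun crd :: "point \<Rightarrow> nat \<Rightarrow> nat \<Rightarrow> int" where
  "crd (y1, y2) a b = (if b = 0 then 0 else if a = 1 then y1 ! (b - 1) else if a = 2 then y2 ! (b - 1) else 0)"

fun shift :: "nat \<Rightarrow> nat \<Rightarrow> point \<Rightarrow> point" where
  "shift i j (y1, y2) =
     (map2 (+) y1 (map (unit_coords i j 1) [1, 2, 3, 4]), map2 (+) y2 (map (unit_coords i j 2) [1, 2, 3, 4]))"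

text \<open>The rotation sends the rows 0, 1, 2 to 1, 2, 0. As the coordinates are relative to row 0,
  it acts by \<open>y\<^sub>1 \<mapsto> y\<^sub>0 - y\<^sub>2\<close> and \<open>y\<^sub>2 \<mapsto> y\<^sub>1 - y\<^sub>2\<close> with \<open>y\<^sub>0 = 0\<close>.\<close>

fun rotate_rows :: "point \<Rightarrow> point" where
  "rotate_rows (y1, y2) = (map uminus y2, map2 (-) y1 y2)"

fun swap_rows :: "point \<Rightarrow> point" where
  "swap_rows (y1, y2) = (y2, y1)"

fun swap12_34 :: "int list \<Rightarrow> int list" where
  "swap12_34 [a, b, c, d] = [b, a, d, c]" | "swap12_34 ys = ys"

fun swap13_24 :: "int list \<Rightarrow> int list" where
  "swap13_24 [a, b, c, d] = [c, d, a, b]" | "swap13_24 ys = ys"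

text \<open>An entry \<open>(c, y)\<close> of the table for \<open>(i, j)\<close> is the coefficient \<open>c\<close> of the edge from \<open>y\<close> to
  \<open>y + e\<^sub>i\<^sub>j\<close>. The solution was found by lattice reduction among the chains that are invariant under
  the rotation of the rows and the column permutation \<open>(1 2)(3 4)\<close>. It is also invariant under the
  transposition of the rows 1 and 2 combined with the column permutation \<open>(1 3)(2 4)\<close>, so the
  entries for the edges \<open>(0, 0)\<close> and \<open>(0, 1)\<close> determine it.\<close>

definition col0_table :: "(int \<times> point) list" where
  "col0_table =
  [(2, [0,-1,0,-1], [0,-1,0,-1]),
   (2, [-1,0,-1,0], [-1,0,-1,0]),
   (1, [0,0,1,0], [-1,-1,0,-1]),
   (1, [0,0,0,1], [-1,-1,-1,0]),
   (1, [0,0,0,0], [0,-1,0,0]),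
   (1, [0,0,0,0], [0,-1,0,-1]),
   (1, [0,0,0,0], [-1,0,0,0]),
   (1, [0,0,0,0], [-1,0,-1,0]),
   (1, [0,0,0,-1], [0,0,0,0]),
   (1, [0,0,-1,0], [0,0,0,0]),
   (1, [0,-1,0,-1], [0,0,0,0]),
   (1, [0,-1,0,-1], [-1,-1,-1,-1]),
   (1, [0,-1,-1,-1], [1,0,0,0]),
   (1, [-1,0,-1,0], [0,0,0,0]),
   (1, [-1,0,-1,0], [-1,-1,-1,-1]),
   (1, [-1,0,-1,-1], [0,1,0,0]),
   (1, [-1,-1,-1,-1], [0,-1,0,-1]),
   (1, [-1,-1,-1,-1], [-1,0,-1,0]),
   (1, [-1,-1,-1,-1], [-1,-1,-1,-2]),
   (1, [-1,-1,-1,-1], [-1,-1,-2,-1]),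
   (1, [-1,-2,-1,-1], [-1,-1,-1,-1]),
   (1, [-2,-1,-1,-1], [-1,-1,-1,-1]),
   (-1, [0,0,0,-1], [0,-1,0,-1]),
   (-1, [0,0,-1,0], [-1,0,-1,0]),
   (-1, [0,-1,0,0], [-1,-1,-1,0]),
   (-1, [0,-1,0,-1], [0,-1,0,0]),
   (-1, [0,-1,0,-1], [0,-1,-1,-1]),
   (-1, [0,-1,-1,-1], [0,0,-1,0]),
   (-1, [-1,0,0,0], [-1,-1,0,-1]),
   (-1, [-1,0,-1,0], [-1,0,0,0]),
   (-1, [-1,0,-1,0], [-1,0,-1,-1]),
   (-1, [-1,0,-1,-1], [0,0,0,-1]),
   (-1, [-1,-1,0,-1], [0,-1,0,-1]),
   (-1, [-1,-1,-1,0], [-1,0,-1,0])]"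

definition col1_table :: "(int \<times> point) list" where
  "col1_table =
  [(1, [1,1,1,1], [1,0,1,0]),
   (1, [1,1,1,1], [0,0,0,0]),
   (1, [1,1,0,1], [1,1,1,1]),
   (1, [1,0,1,0], [1,0,1,0]),
   (1, [1,0,1,0], [0,-1,0,-1]),
   (1, [1,0,0,0], [2,1,1,1]),
   (1, [1,0,0,0], [1,0,0,0]),
   (1, [1,0,0,0], [0,0,0,0]),
   (1, [1,0,0,0], [0,0,-1,0]),
   (1, [0,0,0,0], [1,0,1,0]),
   (1, [0,0,0,0], [0,0,0,0]),
   (1, [0,0,-1,0], [1,1,0,1]),
   (1, [0,0,-1,0], [0,0,-1,0]),
   (1, [0,-1,0,-1], [0,-1,-1,-1]),
   (1, [0,-1,-1,-1], [0,0,-1,0]),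
   (1, [-1,-1,-1,-1], [0,-1,-1,-1]),
   (-1, [1,0,0,0], [1,0,-1,0]),
   (-1, [1,0,-1,0], [0,0,-1,0]),
   (-1, [0,0,1,0], [1,0,1,0]),
   (-1, [0,0,0,0], [0,0,1,0])]"

text \<open>The permutation \<open>(1 2)(3 4)\<close> carries column 1 to column 2. Together with
  the transposition of the rows 1 and 2, which fixes row 0, \<open>(1 3)(2 4)\<close> carries it to
  column 3 and the product to column 4.\<close>

definition row0_table :: "nat \<Rightarrow> (int \<times> point) list" where
  "row0_table j =
     (if j = 0 then col0_table
      else if j = 1 then col1_table
      else if j = 2 then map (apsnd (map_prod swap12_34 swap12_34)) col1_table
      else if j = 3 then map (apsnd (swap_rows \<circ> map_prod swap13_24 swap13_24)) col1_table
      else map (apsnd (swap_rows \<circ> map_prod (swap13_24 \<circ> swap12_34) (swap13_24 \<circ> swap12_34))) col1_table)"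

definition table :: "nat \<Rightarrow> nat \<Rightarrow> (int \<times> point) list" where
  "table i j =
     (if i = 0 then row0_table j
      else if i = 1 then map (apsnd rotate_rows) (row0_table j)
      else map (apsnd (rotate_rows \<circ> rotate_rows)) (row0_table j))"

section \<open>Verification of the integral solution by evaluation\<close>

definition boundary_terms :: "nat \<Rightarrow> nat \<Rightarrow> (int \<times> point) list" where
  "boundary_terms i j = concat (map (\<lambda>(c, y). [(c, shift i j y), (- c, y)]) (table i j))"

text \<open>The search tree only makes the evaluation fast; no property of the ordering is needed.\<close>

datatype 'k coeff_tree = Leaf | Node "'k coeff_tree" int 'k "'k coeff_tree"

fun add_term :: "('k \<Rightarrow> 'k \<Rightarrow> bool) \<Rightarrow> int \<Rightarrow> 'k \<Rightarrow> 'k coeff_tree \<Rightarrow> 'k coeff_tree" where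
  "add_term lt c k Leaf = Node Leaf c k Leaf"
| "add_term lt c k (Node l c' k' r) =
     (if k = k' then Node l (c + c') k' r
      else if lt k k' then Node (add_term lt c k l) c' k' r
      else Node l c' k' (add_term lt c k r))"

fun collect_terms :: "('k \<Rightarrow> 'k \<Rightarrow> bool) \<Rightarrow> (int \<times> 'k) list \<Rightarrow> 'k coeff_tree" where
  "collect_terms lt [] = Leaf"
| "collect_terms lt ((c, k) # xs) = add_term lt c k (collect_terms lt xs)"

fun vanishes :: "'k coeff_tree \<Rightarrow> bool" where
  "vanishes Leaf = True"
| "vanishes (Node l c k r) \<longleftrightarrow> c = 0 \<and> vanishes l \<and> vanishes r"

fun tree_sum :: "('k \<Rightarrow> int) \<Rightarrow> 'k coeff_tree \<Rightarrow> int" where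
  "tree_sum f Leaf = 0"
| "tree_sum f (Node l c k r) = c * f k + tree_sum f l + tree_sum f r"

lemma tree_sum_add_term: "tree_sum f (add_term lt c k t) = c * f k + tree_sum f t"
  by (induction t) (auto simp: algebra_simps)

lemma tree_sum_collect_terms: "tree_sum f (collect_terms lt xs) = (\<Sum>x\<leftarrow>xs. fst x * f (snd x))"
  by (induction lt xs rule: collect_terms.induct) (auto simp: tree_sum_add_term)

lemma tree_sum_vanishes: "vanishes t \<Longrightarrow> tree_sum f t = 0"
  by (induction t) auto

fun lex_less :: "int list \<Rightarrow> int list \<Rightarrow> bool" where
  "lex_less (x # xs) (y # ys) \<longleftrightarrow> (if x = y then lex_less xs ys else x < y)"
| "lex_less _ _ = False"

definition cancels :: "(int \<times> point) list \<Rightarrow> bool" where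
  "cancels xs = vanishes (collect_terms (\<lambda>k k'. lex_less (fst k @ snd k) (fst k' @ snd k')) xs)"

lemma cancels_sum: "cancels xs \<Longrightarrow> (\<Sum>x\<leftarrow>xs. fst x * f (snd x)) = (0 :: int)"
  unfolding cancels_def by (drule tree_sum_vanishes[where f = f]) (simp only: tree_sum_collect_terms)

lemma table_rows_cancel: "list_all (\<lambda>i. cancels (concat (map (\<lambda>j. boundary_terms i j) [0, 1, 2, 3, 4]))) [0, 1, 2]"
  by code_simp

lemma table_cols_cancel: "list_all (\<lambda>j. cancels (concat (map (\<lambda>i. boundary_terms i j) [0, 1, 2]))) [0, 1, 2, 3, 4]"
  by code_simp

text \<open>The lengths are checked as well, because \<open>map2\<close> in \<open>shift\<close>
  truncates and \<open>crd\<close> indexes into the lists.\<close>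

lemma table_augmentation:
  "list_all (\<lambda>i. list_all (\<lambda>j. sum_list (map fst (table i j)) = 12 \<and>
     list_all (\<lambda>x. length (fst (snd x)) = 4 \<and> length (snd (snd x)) = 4) (table i j)) [0, 1, 2, 3, 4]) [0, 1, 2]"
  by code_simp

lemma boundary_terms_sum:
  "(\<Sum>x\<leftarrow>boundary_terms i j. fst x * f (snd x)) =
   (\<Sum>x\<leftarrow>table i j. fst x * (f (shift i j (snd x)) - f (snd x)) :: int)"
proof -
  have "(\<Sum>x\<leftarrow>concat (map (\<lambda>(c, y). [(c, shift i j y), (- c, y)]) xs). fst x * f (snd x)) =
    (\<Sum>x\<leftarrow>xs. fst x * (f (shift i j (snd x)) - f (snd x)))" for xs
    by (induction xs) (auto simp: algebra_simps)
  then show ?thesis unfolding boundary_terms_def .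
qed

lemma sum_list_concat_map:
  "(\<Sum>x\<leftarrow>concat (map h js). g x) = (\<Sum>j\<leftarrow>js. \<Sum>x\<leftarrow>h j. (g x :: int))"
  by (induction js) auto

lemma sum_lessThan_3_5:
  fixes h :: "nat \<Rightarrow> int"
  shows "(\<Sum>i<3. h i) = (\<Sum>i\<leftarrow>[0, 1, 2]. h i)" "(\<Sum>j<5. h j) = (\<Sum>j\<leftarrow>[0, 1, 2, 3, 4]. h j)"
  by (simp_all add: eval_nat_numeral lessThan_Suc)

lemma crd_shift:
  assumes "length y1 = 4" "length y2 = 4" "a < 3" "b < 5"
  shows "crd (shift i j (y1, y2)) a b = crd (y1, y2) a b + unit_coords i j a b"
proof -
  obtain u0 u1 u2 u3 v0 v1 v2 v3 where y: "y1 = [u0, u1, u2, u3]" "y2 = [v0, v1, v2, v3]"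
    using assms(1,2) by (auto simp: eval_nat_numeral length_Suc_conv)
  show ?thesis
    using less_3_cases[OF assms(3)] less_5_cases[OF assms(4)] unfolding y
    by (elim disjE) (simp_all add: unit_coords_def)
qed

lemma K35_mem_matroid_class:
  assumes l: "prime l" "l \<noteq> 2" "l \<noteq> 3"
  shows "cycle_matroid (complete_bipartite 3 5) \<in> matroid_class l"
proof -
  have mem: "i \<in> set [0, 1, 2]" if "i < 3" for i :: nat using that by auto
  have mem': "j \<in> set [0, 1, 2, 3, 4]" if "j < 5" for j :: nat using that by auto
  have tab: "sum_list (map fst (table i j)) = 12 \<and>
      (\<forall>x\<in>set (table i j). length (fst (snd x)) = 4 \<and> length (snd (snd x)) = 4)" if "i < 3" "j < 5" for i j
    by (rule bspec[OF bspec[OF table_augmentation[unfolded list_all_iff] mem[OF that(1)]] mem'[OF that(2)]])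
  have rows: "cancels (concat (map (\<lambda>j. boundary_terms i j) [0, 1, 2, 3, 4]))" if "i < 3" for i
    by (rule bspec[OF table_rows_cancel[unfolded list_all_iff] mem[OF that]])
  have cols: "cancels (concat (map (\<lambda>i. boundary_terms i j) [0, 1, 2]))" if "j < 5" for j
    by (rule bspec[OF table_cols_cancel[unfolded list_all_iff] mem'[OF that]])
  have "\<exists>b. is_solution l (3 + 5 - 1) (bip_edges 3 5) (cut_matrix 3) b \<and>
    (\<forall>s\<in>bip_edges 3 5. color_profile l (bip_edges 3 5)
       (Alb_edges l (bip_edges 3 5) (row_lattice_mod l (3 + 5 - 1) (bip_edges 3 5) (cut_matrix 3))) (b s) s
       = 12 mod int l)"
  proof (rule ex_solution_if_formal_solution[where T = table and crd = crd and sh = shift])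
    show "0 < l" using l(1) prime_gt_0_nat by blast
    show "crd (shift i j (snd x)) a b = crd (snd x) a b + unit_coords i j a b"
      if "i < 3" "j < 5" "x \<in> set (table i j)" "a < 3" "b < 5" for i j x a b
    proof -
      have "length (fst (snd x)) = 4" "length (snd (snd x)) = 4"
        using tab[OF that(1,2)] that(3) by auto
      from crd_shift[OF this that(4,5)] show ?thesis by simp
    qed
    show "(\<Sum>j<5. \<Sum>x\<leftarrow>table i j. fst x * (f (shift i j (snd x)) - f (snd x))) = 0" if "i < 3" for i and f :: "point \<Rightarrow> int"
      using cancels_sum[OF rows[OF that], of f]
      unfolding sum_lessThan_3_5 sum_list_concat_map boundary_terms_sum .
    show "(\<Sum>i<3. \<Sum>x\<leftarrow>table i j. fst x * (f (shift i j (snd x)) - f (snd x))) = 0" if "j < 5" for j and f :: "point \<Rightarrow> int"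
      using cancels_sum[OF cols[OF that], of f]
      unfolding sum_lessThan_3_5 sum_list_concat_map boundary_terms_sum .
  qed (use tab in auto)
  then obtain b where sol: "is_solution l (3 + 5 - 1) (bip_edges 3 5) (cut_matrix 3) b"
    and prof: "\<forall>s\<in>bip_edges 3 5. color_profile l (bip_edges 3 5)
       (Alb_edges l (bip_edges 3 5) (row_lattice_mod l (3 + 5 - 1) (bip_edges 3 5) (cut_matrix 3))) (b s) s
       = 12 mod int l" by blast
  \<comment> \<open>The only prime factors of the augmentation 12 are 2 and 3, so it is a nonzero
    residue modulo \<open>l\<close>.\<close>
  have "\<not> l dvd 12"
  proof
    assume "l dvd 12"
    then have "l dvd 2 * (2 * 3)" by simp
    then have "l dvd 2 \<or> l dvd 3" unfolding prime_dvd_mult_iff[OF l(1)] by blast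
    then show False using l primes_dvd_imp_eq[of l 2] primes_dvd_imp_eq[of l 3] by auto
  qed
  then have "\<not> int l dvd 12" using int_dvd_int_iff[of l 12] by simp
  then have "12 mod int l \<in> Fl l - {0}"
    using prime_gt_0_nat[OF l(1)] by (auto simp: Fl_def dvd_eq_mod_eq_0)
  moreover have "regular_matroid (cycle_matroid (complete_bipartite 3 5))"
    by (rule regular_cycle_matroid_bip) simp_all
  moreover have "realizes (3 + 5 - 1) (cut_matrix 3) (cycle_matroid (complete_bipartite 3 5))"
    by (rule realizes_cut_matrix) simp_all
  ultimately show ?thesis
    unfolding matroid_class_def mem_Collect_eq ground_cycle_matroid_bip using sol prof by blast
qed

theorem corollary4p2:
  shows "radical_distance (cycle_matroid (complete_bipartite 3 5)) = 6"
proof -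
  have "{l. prime l \<and> cycle_matroid (complete_bipartite 3 5) \<notin> matroid_class l} = {2, 3 :: nat}"
    using K35_mem_matroid_class K35_not_mem_matroid_class_2 K35_not_mem_matroid_class_3 by auto
  then show ?thesis unfolding radical_distance_def by (simp add: lcm_nat_def)
qed

end
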